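(* Let $d>1$ be a squarefree integer and let $R$ be the ring of integers of $\mathbb{Q}(\sqrt d)\subset\mathbb{R}$. Let $u\in R$ be a unit of norm $1$ with $u>0$ and $u\neq1$, and let $\Delta=(\Delta_n)_{n\geqslant1}$ with $\Delta_n=N_{\mathbb{Q}(\sqrt d)/\mathbb{Q}}(u^n-1)$. If $u<\frac16$ or $u>6$, then $Z(\Delta)\leqslant6$. For all other such units $u$, one of the following holds: (1) $u=3+2\sqrt2$ or $u=3-2\sqrt2$, where $Z(\Delta)=2$; (2) $u=2+\sqrt3$ or $u=2-\sqrt3$, where $Z(\Delta)=6$ and the only terms without a primitive prime divisor are $\Delta_4$ and $\Delta_6$; (3) $u=\frac{3+\sqrt5}{2}$ or $u=\frac{3-\sqrt5}{2}$, where $Z(\Delta)=12$ and the only terms without a primitive prime divisor are $\Delta_6$, $\Delta_{10}$ and $\Delta_{12}$; (4) $u=\frac{5+\sqrt{21}}{2}$ or $u=\frac{5-\sqrt{21}}{2}$, where $Z(\Delta)=6$ and the only term without a primitive prime divisor is $\Delta_6$.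
   Context: For an integer sequence $A=(a_n)_{n\geqslant1}$, a prime $p$ dividing a term $a_n$ is called a primitive prime divisor of $a_n$ if $p$ does not divide $a_m$ for any $m<n$ with $a_m\neq0$. The Zsigmondy bound of $A$ is $Z(A)=\max\{n: a_n\text{ does not have a primitive prime divisor}\}$ if this set is finite, and $Z(A)=\infty$ otherwise. $N_{\mathbb{Q}(\sqrt d)/\mathbb{Q}}$ denotes the field norm.
   Formalization: In case (3) the list of terms without a primitive prime divisor is corrected to Δ_1, Δ_6, Δ_10, Δ_12, because Δ_1 = -1 has no prime divisor at all. *)

theory Defs
  imports
    Complex_Main
    "HOL-Computational_Algebra.Computational_Algebra"
    "HOL-Library.Extended_Nat"
    "HOL-Library.FuncSet"
begin

definition quadratic_field :: "int \<Rightarrow> real set" where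
  "quadratic_field d = {of_rat a + of_rat b * sqrt (of_int d) | a b. True}"

definition ring_of_integers :: "real set \<Rightarrow> real set" where
  "ring_of_integers K = {x \<in> K. algebraic_int x}"

definition ring_unit :: "real set \<Rightarrow> real \<Rightarrow> bool" where
  "ring_unit R u \<longleftrightarrow> u \<in> R \<and> (\<exists>v\<in>R. u * v = 1)"

(* Extensionality makes each field embedding K \<rightarrow> \<complex> a single HOL function. *)
definition field_embeddings :: "real set \<Rightarrow> (real \<Rightarrow> complex) set" where
  "field_embeddings K = {\<sigma> \<in> extensional K. \<sigma> 1 = 1 \<and>
     (\<forall>x\<in>K. \<forall>y\<in>K. \<sigma> (x + y) = \<sigma> x + \<sigma> y \<and> \<sigma> (x * y) = \<sigma> x * \<sigma> y)}"

(* N_{K/\<rat>}(x), as the product of the conjugates of x; meant for number fields K,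
   for which the set of embeddings is finite. *)
definition field_norm :: "real set \<Rightarrow> real \<Rightarrow> complex" where
  "field_norm K x = (\<Prod>\<sigma>\<in>field_embeddings K. \<sigma> x)"

(* The norm of an algebraic integer is a rational integer, so for u in the ring of integers
   the description below denotes N(u^n - 1) as an element of \<int>. *)
definition lehmer_pierce :: "int \<Rightarrow> real \<Rightarrow> nat \<Rightarrow> int" where
  "lehmer_pierce d u n = (THE k. of_int k = field_norm (quadratic_field d) (u ^ n - 1))"

(* Integer sequences are indexed by n \<ge> 1; the value at 0 is irrelevant. *)
definition primitive_prime_divisor :: "(nat \<Rightarrow> int) \<Rightarrow> nat \<Rightarrow> int \<Rightarrow> bool" where
  "primitive_prime_divisor a n p \<longleftrightarrow>
     prime p \<and> p dvd a n \<and> (\<forall>m. 1 \<le> m \<and> m < n \<and> a m \<noteq> 0 \<longrightarrow> \<not> p dvd a m)"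

(* A term equal to 1 or -1 has no prime divisor at all, so its index belongs to this set;
   for u = (3 \<plusminus> sqrt 5) / 2 this happens at n = 1, where N(u - 1) = -1. *)
definition no_primitive_indices :: "(nat \<Rightarrow> int) \<Rightarrow> nat set" where
  "no_primitive_indices a = {n. 1 \<le> n \<and> \<not> (\<exists>p. primitive_prime_divisor a n p)}"

(* If every term has a primitive prime divisor, the maximum of the empty set is read as 0. *)
definition zsigmondy_bound :: "(nat \<Rightarrow> int) \<Rightarrow> enat" where
  "zsigmondy_bound a =
     (let S = no_primitive_indices a
      in if finite S then (if S = {} then 0 else enat (Max S)) else \<infinity>)"

end

theory Submission
  imports Defs "HOL-Number_Theory.Number_Theory"
begin

text \<open>
  Put \<open>t = u + 1/u\<close>, an integer with \<open>t \<ge> 3\<close>, so that \<open>- \<Delta>\<^sub>n = D\<^sub>n = u\<^sup>n + 1/u\<^sup>n - 2 > 0\<close>.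
  For a prime \<open>p\<close> the indices \<open>n\<close> with \<open>p\<close> dividing \<open>D\<^sub>n\<close> are the multiples of a rank \<open>z(p)\<close>, which
  divides \<open>p - 1\<close> or \<open>p + 1\<close>, and lifting the exponent describes the \<open>p\<close>-adic valuation of \<open>D\<^sub>n\<close>
  along these multiples. Consider the Moebius sum \<open>h(n) = (\<Sum>d | d dvd n. \<mu>(n/d) ln D\<^sub>d)\<close>, which is
  the logarithm of the norm of the \<open>n\<close>-th cyclotomic polynomial at \<open>u\<close>. If \<open>n > 6\<close> and \<open>D\<^sub>n\<close> has no
  primitive prime divisor, only primes \<open>p\<close> with \<open>n = z(p) p\<^sup>j\<close> contribute to \<open>h(n)\<close>, each of them
  \<open>2 ln p\<close>, and since \<open>z(p) \<le> p + 1\<close> there is at most one such prime, or they are 2 and 3.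
  On the other hand, taking \<open>u > 1\<close> and \<open>x = 1/u\<close>,
  \<open>h(n) \<ge> \<phi>(n) ln u + 2 ln (\<Prod>d. 1 - x\<^sup>d) \<ge> \<phi>(n) ln u + 2 ln (1 - x - x\<^sup>2)\<close>.
  The two estimates are compatible only for \<open>t = 3\<close> and \<open>n \<in> {10, 12}\<close>; the indices up to 6 are
  checked directly.
\<close>

section \<open>The trace sequence\<close>

text \<open>Write V_n for these terms. They equal u^n + 1/u^n for u + 1/u = t, the Dickson
  polynomial of degree n at t (a rescaled Chebyshev polynomial).\<close>

fun trace_seq :: "int \<Rightarrow> nat \<Rightarrow> int" where
  "trace_seq t 0 = 2"
| "trace_seq t (Suc 0) = t"
| "trace_seq t (Suc (Suc n)) = t * trace_seq t (Suc n) - trace_seq t n"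

text \<open>This is the D_n of the overview, the Lehmer-Pierce sequence with its sign
  reversed.\<close>

definition lp_seq :: "int \<Rightarrow> nat \<Rightarrow> int" where
  "lp_seq t n = trace_seq t n - 2"

lemma trace_seq_closed_form:
  fixes u v :: real
  assumes "u * v = 1" "u + v = of_int t"
  shows "of_int (trace_seq t n) = u ^ n + v ^ n"
proof (induction n rule: induct_nat_012)
  case (ge2 n)
  have "u ^ Suc (Suc n) + v ^ Suc (Suc n) =
      (u + v) * (u ^ Suc n + v ^ Suc n) - (u * v) * (u ^ n + v ^ n)"
    by (simp add: algebra_simps)
  then show ?case using ge2 assms by simp
qed (use assms in auto)

text \<open>Multiply out (u^(k+n) + 1/u^(k+n)) (u^n + 1/u^n). Naming the outer indices k + 2 n and k
  avoids subtraction. The induction needs all k at once, since its step uses the hypotheses at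
  shifted k.\<close>

lemma trace_seq_add: "trace_seq t (k + 2 * n) + trace_seq t k = trace_seq t (k + n) * trace_seq t n"
proof (induction n arbitrary: k rule: induct_nat_012)
  case (ge2 n)
  have 1: "trace_seq t (Suc (Suc (k + 2 * n))) + trace_seq t (Suc (Suc k)) =
      trace_seq t (Suc (Suc (k + n))) * trace_seq t n"
    using ge2(1)[of "Suc (Suc k)"] by simp
  have 2: "trace_seq t (Suc (Suc (Suc (k + 2 * n)))) + trace_seq t (Suc k) =
      trace_seq t (Suc (Suc (k + n))) * trace_seq t (Suc n)"
    using ge2(2)[of "Suc k"] by simp
  have "trace_seq t (k + 2 * Suc (Suc n)) + trace_seq t k =
      t * (trace_seq t (Suc (Suc (Suc (k + 2 * n)))) + trace_seq t (Suc k))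
       - (trace_seq t (Suc (Suc (k + 2 * n))) + trace_seq t (Suc (Suc k)))"
    by (simp add: algebra_simps)
  also have "\<dots> = trace_seq t (Suc (Suc (k + n))) * (t * trace_seq t (Suc n) - trace_seq t n)"
    unfolding 1 2 by (simp add: algebra_simps)
  finally show ?case by simp
qed (auto simp: algebra_simps)

lemma trace_seq_add': "m \<le> n \<Longrightarrow> trace_seq t (n + m) + trace_seq t (n - m) = trace_seq t n * trace_seq t m"
  using trace_seq_add[of t "n - m" m] by (simp add: mult_2)

lemma trace_seq_double: "trace_seq t (2 * n) = (trace_seq t n)\<^sup>2 - 2"
  using trace_seq_add[of t 0 n] by (simp add: power2_eq_square mult.commute)

text \<open>Composition law of Dickson polynomials: passing from u to u^m replaces t by V_m. It
  reduces claims about multiples of m to the case m = 1 with trace V_m.\<close>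

lemma trace_seq_mult: "trace_seq t (m * k) = trace_seq (trace_seq t m) k"
proof (induction k rule: induct_nat_012)
  case (ge2 k)
  have "trace_seq t (m * Suc (Suc k)) + trace_seq t (m * k) = trace_seq t (m * Suc k) * trace_seq t m"
    using trace_seq_add[of t "m * k" m] by (simp add: mult_2 add_ac)
  then show ?case using ge2 by (simp add: mult.commute)
qed auto

lemma lp_seq_mult: "lp_seq t (m * k) = lp_seq (trace_seq t m) k"
  by (simp add: lp_seq_def trace_seq_mult)

section \<open>Divisibility, positivity and expansions of D_n\<close>

lemma lp_seq_0 [simp]: "lp_seq t 0 = 0"
  by (simp add: lp_seq_def)

lemma lp_seq_1 [simp]: "lp_seq t 1 = t - 2" "lp_seq t (Suc 0) = t - 2"
  by (simp_all add: lp_seq_def)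

lemma lp_seq_double: "lp_seq t (2 * n) = lp_seq t n * (lp_seq t n + 4)"
  unfolding lp_seq_def trace_seq_double by (simp add: power2_eq_square algebra_simps)

lemma lp_seq_rec: "lp_seq t (Suc (Suc n)) = (t - 2) * (lp_seq t (Suc n) + 2) + 2 * lp_seq t (Suc n) - lp_seq t n"
  by (simp add: lp_seq_def algebra_simps)

text \<open>As a polynomial in t - 2, D_k begins with k^2 (t - 2). With V_m in place of t this gives
  D_m | D_(mk) and the quotient k^2 modulo D_m.\<close>

lemma lp_seq_cong: "(t - 2)\<^sup>2 dvd lp_seq t k - (int k)\<^sup>2 * (t - 2)"
proof (induction k rule: induct_nat_012)
  case (ge2 k)
  define e f where "e = lp_seq t k - (int k)\<^sup>2 * (t - 2)"
    and "f = lp_seq t (Suc k) - (int (Suc k))\<^sup>2 * (t - 2)"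
  have "lp_seq t (Suc (Suc k)) - (int (Suc (Suc k)))\<^sup>2 * (t - 2)
      = (t - 2) * f + (t - 2)\<^sup>2 * (int (Suc k))\<^sup>2 + 2 * f - e"
    unfolding lp_seq_rec e_def f_def by (simp add: power2_eq_square algebra_simps)
  moreover have "(t - 2)\<^sup>2 dvd e" "(t - 2)\<^sup>2 dvd f" using ge2 by (auto simp: e_def f_def)
  ultimately show ?case by auto
qed auto

lemma lp_seq_dvd_mult: "lp_seq t m dvd lp_seq t (m * k)"
proof -
  have *: "T - 2 dvd lp_seq T k" for T
  proof -
    have "T - 2 dvd (T - 2)\<^sup>2" by (simp add: power2_eq_square)
    then have "T - 2 dvd lp_seq T k - (int k)\<^sup>2 * (T - 2)" using lp_seq_cong dvd_trans by blast
    then have "T - 2 dvd (lp_seq T k - (int k)\<^sup>2 * (T - 2)) + (int k)\<^sup>2 * (T - 2)"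
      by (rule dvd_add) simp
    then show ?thesis by simp
  qed
  show ?thesis using *[of "trace_seq t m"] by (simp add: lp_seq_def trace_seq_mult)
qed

lemma lp_seq_dvd: "m dvd n \<Longrightarrow> lp_seq t m dvd lp_seq t n"
  using lp_seq_dvd_mult by (auto elim!: dvdE)

lemma trace_seq_step:
  assumes "t \<ge> 3"
  shows "trace_seq t n \<ge> 2 \<and> trace_seq t (Suc n) > trace_seq t n"
proof (induction n)
  case (Suc n)
  have "3 * trace_seq t (Suc n) \<le> t * trace_seq t (Suc n)"
    using Suc assms by (intro mult_right_mono) auto
  moreover have "trace_seq t (Suc n) > 0" "trace_seq t (Suc n) > trace_seq t n" using Suc by auto
  ultimately show ?case using Suc unfolding trace_seq.simps by linarith
qed (use assms in auto)

lemma lp_seq_pos: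
  assumes "t \<ge> 3" "n > 0"
  shows "lp_seq t n > 0"
proof -
  obtain k where "n = Suc k" using assms(2) gr0_implies_Suc by blast
  then show ?thesis using trace_seq_step[OF assms(1), of k] by (simp add: lp_seq_def)
qed

text \<open>With u = a^2 one has D_n = (a^n - 1/a^n)^2, and the product of these roots at n + 2 and
  n is V_(n+1) - t. For n + 1 = p prime the right side vanishes modulo p, which bounds the rank of
  p.\<close>

lemma lp_seq_neighbours: "lp_seq t (Suc (Suc n)) * lp_seq t n = (trace_seq t (Suc n) - t)\<^sup>2"
proof -
  have "trace_seq t (Suc (Suc n)) * trace_seq t n = (trace_seq t (Suc n))\<^sup>2 + t\<^sup>2 - 4"
  proof -
    have "trace_seq t (2 * Suc n) + trace_seq t (2 * 1) = trace_seq t (Suc (Suc n)) * trace_seq t n"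
      using trace_seq_add[of t "2 * 1" n] by simp
    then show ?thesis unfolding trace_seq_double by simp
  qed
  then show ?thesis by (simp add: lp_seq_def algebra_simps power2_eq_square)
qed

text \<open>With \<open>t = a\<^sup>2 + 1/a\<^sup>2\<close> and \<open>k = 2 j + 1\<close>, the witness is
  \<open>B = (a\<^sup>k - 1/a\<^sup>k) / (a - 1/a)\<close>; the divisibility is its expansion at \<open>t = 2\<close>, scaled by 6
  to keep the coefficients integral.\<close>
lemma lp_seq_odd:
  assumes "t \<noteq> 2"
  shows "\<exists>B. lp_seq t (2 * j + 1) = (t - 2) * B\<^sup>2 \<and>
    (t - 2)\<^sup>2 dvd 6 * B - (2 * int j + 1) * (6 + int j * (int j + 1) * (t - 2))"
proof -
  \<comment> \<open>The square B^2 does not follow a two-step recurrence, but B does, through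
    V_(j+1) - V_j = (t - 2) B. The square of this difference is (t - 2) D_(2j+1), as shown at the
    end.\<close>
  define P where "P = (\<lambda>j B. trace_seq t (Suc j) - trace_seq t j = (t - 2) * B \<and>
    (t - 2)\<^sup>2 dvd 6 * B - (2 * int j + 1) * (6 + int j * (int j + 1) * (t - 2)))"
  have "\<exists>B. P j B"
  proof (induction j rule: induct_nat_012)
    case 0
    show ?case by (intro exI[of _ 1]) (simp add: P_def)
  next
    case 1
    show ?case by (intro exI[of _ "t + 1"]) (simp add: P_def algebra_simps)
  next
    case (ge2 j)
    then obtain B C where B: "P j B" and C: "P (Suc j) C" by blast
    have 1: "trace_seq t (Suc (Suc (Suc j))) - trace_seq t (Suc (Suc j)) = (t - 2) * (t * C - B)"
    proof -
      have "trace_seq t (Suc (Suc (Suc j))) - trace_seq t (Suc (Suc j)) =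
        t * (trace_seq t (Suc (Suc j)) - trace_seq t (Suc j)) - (trace_seq t (Suc j) - trace_seq t j)"
        by (simp add: algebra_simps)
      then show ?thesis using B C unfolding P_def by (simp only:) (simp add: algebra_simps)
    qed
    define x n where "x = t - 2" and "n = int j"
    define e where "e = 6 * B - (2 * n + 1) * (6 + n * (n + 1) * x)"
    define f where "f = 6 * C - (2 * n + 3) * (6 + (n + 1) * (n + 2) * x)"
    have "6 * (t * C - B) - (2 * n + 5) * (6 + (n + 2) * (n + 3) * x) =
      x * f + x\<^sup>2 * ((2 * n + 3) * (n + 1) * (n + 2)) + 2 * f - e"
    proof -
      have "t = x + 2" by (simp add: x_def)
      then show ?thesis unfolding e_def f_def by (simp add: power2_eq_square algebra_simps)
    qed
    moreover have "x\<^sup>2 dvd e" "x\<^sup>2 dvd f" using B C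
      by (simp_all add: P_def e_def f_def x_def n_def algebra_simps)
    ultimately have "x\<^sup>2 dvd 6 * (t * C - B) - (2 * n + 5) * (6 + (n + 2) * (n + 3) * x)"
      by (simp only:) (intro dvd_diff[of _ "_ + _"] dvd_add dvd_mult[of "x\<^sup>2" f] dvd_triv_left)
    then have 2: "(t - 2)\<^sup>2 dvd 6 * (t * C - B) - (2 * int (Suc (Suc j)) + 1) *
        (6 + int (Suc (Suc j)) * (int (Suc (Suc j)) + 1) * (t - 2))"
      by (simp add: x_def n_def algebra_simps)
    show ?case using 1 2 unfolding P_def by blast
  qed
  then obtain B where B: "P j B" ..
  have "(t - 2) * lp_seq t (2 * j + 1) = (trace_seq t (Suc j) - trace_seq t j)\<^sup>2"
  proof -
    have "trace_seq t (2 * j + 1) + t = trace_seq t (Suc j) * trace_seq t j"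
      using trace_seq_add[of t 1 j] by (simp add: algebra_simps)
    moreover have "trace_seq t (Suc (Suc (2 * j))) = (trace_seq t (Suc j))\<^sup>2 - 2"
      using trace_seq_double[of t "Suc j"] by simp
    ultimately show ?thesis using trace_seq_double[of t j]
      by (simp add: lp_seq_def power2_eq_square algebra_simps)
  qed
  also have "trace_seq t (Suc j) - trace_seq t j = (t - 2) * B" using B by (simp add: P_def)
  also have "((t - 2) * B)\<^sup>2 = (t - 2) * ((t - 2) * B\<^sup>2)"
    by (simp add: power2_eq_square algebra_simps)
  finally have "lp_seq t (2 * j + 1) = (t - 2) * B\<^sup>2" using assms by simp
  then show ?thesis using B unfolding P_def by blast
qed

text \<open>Frobenius: modulo p, the binomial expansion of t^p = (u + v)^p leaves only u^p + v^p =
  V_p, and t^p = t by Fermat. The prime 2 is separate because a factor 2 has to be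
  cancelled.\<close>

lemma trace_seq_prime_cong:
  fixes p :: nat
  assumes "prime p" "t \<ge> 3"
  shows "int p dvd trace_seq t p - t"
proof (cases "p = 2")
  case True
  have "trace_seq t 2 - t = t * t - t - 2" by (simp add: numeral_2_eq_2)
  moreover have "even (t * t - t - 2)" by simp
  ultimately have "int 2 dvd trace_seq t 2 - t" by simp
  then show ?thesis unfolding True .
next
  case False
  then have p: "p > 2" using assms prime_ge_2_nat[of p] by auto
  define s where "s = sqrt ((real_of_int t)\<^sup>2 - 4)"
  define u v where "u = (t + s) / 2" and "v = (t - s) / 2"
  have t2: "(real_of_int t)\<^sup>2 \<ge> 3\<^sup>2" using assms by (intro power_mono) auto
  have uv: "u * v = 1" "u + v = t"
  proof -
    have "u * v = ((real_of_int t)\<^sup>2 - s\<^sup>2) / 4"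
      by (simp add: u_def v_def field_simps power2_eq_square)
    also have "s\<^sup>2 = t\<^sup>2 - 4" unfolding s_def using t2 by simp
    finally show "u * v = 1" by simp
  qed (simp add: u_def v_def field_simps)
  \<comment> \<open>This is the absolute value of p - 2 k: since u v = 1, the common power cancels
    in u^k v^(p-k) + v^k u^(p-k).\<close>
  define m where "m = (\<lambda>k. if 2 * k \<le> p then p - 2 * k else 2 * k - p)"
  have *: "u ^ k * v ^ (p - k) + v ^ k * u ^ (p - k) = trace_seq t (m k)" if "k \<le> p" for k
  proof (cases "2 * k \<le> p")
    case True
    define q r where "q = p - k" and "r = p - 2 * k"
    have "q = k + r" using that True by (simp add: q_def r_def)
    then have "u ^ k * v ^ q + v ^ k * u ^ q = (u * v) ^ k * (u ^ r + v ^ r)"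
      by (simp add: power_add power_mult_distrib distrib_left)
    then have "u ^ k * v ^ (p - k) + v ^ k * u ^ (p - k) = (u * v) ^ k * (u ^ (p - 2 * k) + v ^ (p - 2 * k))"
      unfolding q_def r_def .
    then show ?thesis using True uv trace_seq_closed_form[OF uv] by (simp add: m_def)
  next
    case False
    define q r where "q = p - k" and "r = 2 * k - p"
    have "k = q + r" using that False by (simp add: q_def r_def)
    then have "u ^ k * v ^ q + v ^ k * u ^ q = (u * v) ^ q * (u ^ r + v ^ r)"
      by (simp add: power_add power_mult_distrib distrib_left)
    then have "u ^ k * v ^ (p - k) + v ^ k * u ^ (p - k) = (u * v) ^ (p - k) * (u ^ (2 * k - p) + v ^ (2 * k - p))"
      unfolding q_def r_def .
    then show ?thesis using False uv trace_seq_closed_form[OF uv] by (simp add: m_def)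
  qed
  \<comment> \<open>Adding the expansion to its mirror image makes every summand symmetric in u and
    v, hence an integer multiple of a trace, so the identity descends to the integers.\<close>
  have "2 * real_of_int t ^ p = (u + v) ^ p + (v + u) ^ p" using uv by (simp add: add.commute)
  also have "\<dots> = (\<Sum>k\<le>p. of_nat (p choose k) * (u ^ k * v ^ (p - k) + v ^ k * u ^ (p - k)))"
    unfolding binomial_ring by (simp add: sum.distrib[symmetric] algebra_simps)
  also have "\<dots> = (\<Sum>k\<le>p. of_int (int (p choose k) * trace_seq t (m k)))"
    by (intro sum.cong) (auto simp: *)
  also have "\<dots> = of_int (\<Sum>k\<le>p. int (p choose k) * trace_seq t (m k))" by simp
  finally have "real_of_int (2 * t ^ p) = of_int (\<Sum>k\<le>p. int (p choose k) * trace_seq t (m k))" by simp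
  then have eq: "2 * t ^ p = (\<Sum>k\<le>p. int (p choose k) * trace_seq t (m k))"
    unfolding of_int_eq_iff .
  have "{..p} = insert 0 (insert p {0<..<p})" using p by auto
  then have eq': "2 * t ^ p = 2 * trace_seq t p + (\<Sum>k\<in>{0<..<p}. int (p choose k) * trace_seq t (m k))"
    unfolding eq using p by (simp add: m_def)
  moreover have "int p dvd (\<Sum>k\<in>{0<..<p}. int (p choose k) * trace_seq t (m k))"
  proof (intro dvd_sum dvd_mult2)
    fix k assume "k \<in> {0<..<p}"
    then have "p dvd (p choose k)" using assms(1) by (intro dvd_choose_prime) auto
    then show "int p dvd int (p choose k)" by simp
  qed
  moreover have "2 * (trace_seq t p - t) =
      2 * (t ^ p - t) - (\<Sum>k\<in>{0<..<p}. int (p choose k) * trace_seq t (m k))"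
    using eq' by simp
  moreover have "int p dvd t ^ p - t"
  proof (cases "int p dvd t")
    case True
    moreover have "t dvd t ^ p" using p by (intro dvd_power) auto
    ultimately show ?thesis using dvd_trans by (intro dvd_diff) blast+
  next
    case False
    obtain a where a: "t = int a" using assms(2) by (intro that[of "nat t"]) simp
    then have "[a ^ (p - 1) = 1] (mod p)" using False assms(1) by (intro fermat_theorem) auto
    then have "[a ^ (p - 1) * a = 1 * a] (mod p)" by (rule cong_scalar_right)
    moreover have "a ^ (p - 1) * a = a ^ p" using p by (intro power_minus_mult) simp
    ultimately have "[a ^ p = a] (mod p)" by simp
    then have "[t ^ p = t] (mod int p)" unfolding a by (metis cong_int_iff of_nat_power)
    then show ?thesis by (simp add: cong_iff_dvd_diff)
  qed
  ultimately have "int p dvd 2 * (trace_seq t p - t)" by (metis dvd_diff dvd_mult)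
  moreover have "\<not> int p dvd 2" using p zdvd_not_zless[of 2 "int p"] by auto
  ultimately show ?thesis
    using assms(1) prime_dvd_mult_iff[of "int p" 2 "trace_seq t p - t"] by simp
qed

section \<open>Moebius sums and elementary estimates\<close>

definition moebius :: "nat \<Rightarrow> int" where
  "moebius n = (if squarefree n then (-1) ^ card (prime_factors n) else 0)"

lemma abs_moebius_le_1: "\<bar>moebius n\<bar> \<le> 1"
  by (simp add: moebius_def power_abs)

lemma moebius_1 [simp]: "moebius (Suc 0) = 1"
  by (simp add: moebius_def)

lemma moebius_prime_mult:
  assumes "prime p" "\<not> p dvd d"
  shows "moebius (p * d) = - moebius d"
proof -
  have "d \<noteq> 0" using assms by (intro notI) simp
  have "coprime p d" using assms by (simp add: prime_imp_coprime)
  then have "squarefree (p * d) \<longleftrightarrow> squarefree d"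
    using squarefree_mult_coprime[of p d] squarefree_prime[OF assms(1)] squarefree_multD(2)[of p d]
    by blast
  moreover have "prime_factors (p * d) = insert p (prime_factors d)"
    using assms \<open>d \<noteq> 0\<close> by (auto simp: prime_factors_product prime_prime_factors)
  moreover have "p \<notin> prime_factors d" using assms by auto
  ultimately show ?thesis by (simp add: moebius_def)
qed

lemma moebius_not_squarefree:
  assumes "prime p" "p dvd d"
  shows "moebius (p * d) = 0"
proof -
  have "p\<^sup>2 dvd p * d" using assms by (simp add: power2_eq_square)
  then have "\<not> squarefree (p * d)" using assms unfolding squarefree_def
    by (metis not_prime_unit)
  then show ?thesis by (simp add: moebius_def)
qed

text \<open>For a prime p dividing n, each divisor d prime to p cancels against p d; the remaining
  divisors are multiples of p^2.\<close>

lemma sum_moebius: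
  assumes "n > 0"
  shows "(\<Sum>d | d dvd n. moebius d) = (if n = 1 then 1 else 0)"
proof (cases "n = 1")
  case False
  then obtain p where p: "prime p" "p dvd n" using prime_factor_nat by blast
  define A where "A = {d. d dvd n \<and> \<not> p dvd d}"
  have fin: "finite {d. d dvd n}" using assms by simp
  have *: "p * d dvd n" if "d \<in> A" for d
  proof -
    have "coprime p d" using that p by (simp add: A_def prime_imp_coprime)
    then show ?thesis using that p by (simp add: A_def divides_mult)
  qed
  have "(\<Sum>d | d dvd n. moebius d) = (\<Sum>d\<in>A \<union> (*) p ` A. moebius d)"
  proof (intro sum.mono_neutral_right fin ballI)
    show "A \<union> (*) p ` A \<subseteq> {d. d dvd n}" using * by (auto simp: A_def)
    fix d assume d: "d \<in> {d. d dvd n} - (A \<union> (*) p ` A)"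
    then have "p dvd d" by (auto simp: A_def)
    then obtain e where e: "d = p * e" by blast
    then have "p dvd e" using d by (auto simp: A_def dest: dvd_mult_right)
    then show "moebius d = 0" using p e by (simp add: moebius_not_squarefree)
  qed
  also have "\<dots> = (\<Sum>d\<in>A. moebius d) + (\<Sum>d\<in>(*) p ` A. moebius d)"
    by (rule sum.union_disjoint) (use fin in \<open>auto simp: A_def\<close>)
  also have "(\<Sum>d\<in>(*) p ` A. moebius d) = (\<Sum>d\<in>A. moebius (p * d))"
    using p prime_gt_0_nat[of p] by (subst sum.reindex) (auto simp: inj_on_def)
  also have "\<dots> = (\<Sum>d\<in>A. - moebius d)"
    using p by (intro sum.cong) (auto simp: A_def moebius_prime_mult)
  finally show ?thesis using False by (simp add: sum_negf)
qed auto

text \<open>Moebius inversion for indicator functions: the transform of "m divides d" is "m = n". It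
  evaluates the transform of any combination of such indicators.\<close>

lemma sum_moebius_multiples:
  assumes "n > 0"
  shows "(\<Sum>d | d dvd n \<and> m dvd d. moebius (n div d)) = (if m = n then 1 else 0)"
proof (cases "m dvd n")
  case True
  then obtain k where k: "n = m * k" by blast
  have pos: "m > 0" "k > 0" using assms k by auto
  have "(\<Sum>d | d dvd n \<and> m dvd d. moebius (n div d)) = (\<Sum>e | e dvd k. moebius e)"
    using assms pos k
    by (intro sum.reindex_bij_witness[of _ "\<lambda>e. m * (k div e)" "\<lambda>d. k div (d div m)"])
      (auto elim!: dvdE)
  then show ?thesis using sum_moebius[OF pos(2)] k pos by auto
next
  case False
  then have "{d. d dvd n \<and> m dvd d} = {}" using dvd_trans by blast
  then show ?thesis using False by (subst \<open>_ = {}\<close>) auto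
qed

text \<open>Inversion of the divisor sum of the totient; this is the degree of the n-th cyclotomic
  polynomial and becomes the coefficient of ln u.\<close>

lemma sum_moebius_totient:
  assumes "n > 0"
  shows "(\<Sum>d | d dvd n. moebius (n div d) * int d) = int (totient n)"
proof -
  have fin: "finite {d. d dvd n}" using assms by simp
  have "(\<Sum>d | d dvd n. moebius (n div d) * int d) =
      (\<Sum>d | d dvd n. \<Sum>m | m dvd n. if m dvd d then moebius (n div d) * int (totient m) else 0)"
  proof (intro sum.cong refl)
    fix d assume d: "d \<in> {d. d dvd n}"
    have "{m \<in> {m. m dvd n}. m dvd d} = {m. m dvd d}" using d dvd_trans by blast
    moreover have "int d = (\<Sum>m | m dvd d. int (totient m))"
      by (metis totient_divisor_sum of_nat_sum)
    ultimately show "moebius (n div d) * int d =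
        (\<Sum>m | m dvd n. if m dvd d then moebius (n div d) * int (totient m) else 0)"
      using fin by (simp add: sum.If_cases sum_distrib_left Int_def)
  qed
  also have "\<dots> = (\<Sum>m | m dvd n. \<Sum>d | d dvd n. if m dvd d then moebius (n div d) * int (totient m) else 0)"
    by (rule sum.swap)
  also have "\<dots> = (\<Sum>m | m dvd n. (if m = n then 1 else 0) * int (totient m))"
    using fin by (intro sum.cong refl)
      (simp add: sum.If_cases sum_moebius_multiples[OF assms, symmetric] sum_distrib_right Int_def)
  also have "\<dots> = int (totient n)" using fin by (simp add: if_distrib[of "\<lambda>x. x * _"] sum.delta cong: if_cong)
  finally show ?thesis .
qed

text \<open>The first terms of Euler's pentagonal number series. The extra power of x makes the
  induction close: the new factor leaves the surplus x^(n+4) - x^(2n+4), which is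
  nonnegative.\<close>

lemma prod_one_minus_power_ge:
  fixes x :: real
  assumes "0 \<le> x" "x \<le> 1"
  shows "(\<Prod>d=1..Suc n. 1 - x ^ d) \<ge> 1 - x - x\<^sup>2 + x ^ (n + 2)"
proof (induction n)
  case (Suc n)
  have le: "x ^ (Suc n + 2) \<le> 1" using assms by (intro power_le_one) auto
  have le2: "x ^ (2 * n + 4) \<le> x ^ (n + 4)" using assms by (intro power_decreasing) auto
  have "1 - x - x\<^sup>2 + x ^ (Suc n + 2) \<le> (1 - x - x\<^sup>2 + x ^ (n + 2)) * (1 - x ^ (n + 2))"
    using le2 by (simp add: algebra_simps power2_eq_square power_add mult_2 eval_nat_numeral)
  also have "\<dots> \<le> (\<Prod>d=1..Suc n. 1 - x ^ d) * (1 - x ^ (n + 2))"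
    using Suc assms by (intro mult_right_mono) (auto intro!: power_le_one mult_le_one)
  also have "\<dots> = (\<Prod>d=1..Suc (Suc n). 1 - x ^ d)" by simp
  finally show ?case .
qed (simp add: power2_eq_square)

text \<open>The totient grows along divisibility, so a counterexample has no divisor of totient at
  least 6. This excludes all primes from 7 on and 9, 15, 16, 20, 24, 25, and leaves a short
  list.\<close>

lemma totient_ge_6:
  assumes "n > 6" "n \<notin> {8, 10, 12}"
  shows "totient n \<ge> 6"
proof (rule ccontr)
  assume less: "\<not> totient n \<ge> 6"
  have nd: "\<not> m dvd n" if "totient m \<ge> 6" for m
    using that less totient_dvd_mono[of m n] assms by auto
  have t15: "totient 15 = 8" using totient_mult_coprime[of 3 5] primes_coprime[of 3 "5::nat"] by simp
  have t20: "totient 20 = 8" using totient_mult_coprime[of 4 5] coprime_Suc_right_nat[of 4] by simp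
  have t24: "totient 24 = 8" using totient_mult_coprime[of 3 8] coprime_power_right_iff[of 3 "2::nat" 3] primes_coprime[of 3 "2::nat"] by simp
  have t16: "totient 16 = 8" using totient_prime_power[of 2 4] by simp
  have t25: "totient 25 = 20" using totient_prime_power[of 5 2] by simp
  have ndv: "\<not> 9 dvd n" "\<not> 15 dvd n" "\<not> 20 dvd n" "\<not> 24 dvd n" "\<not> 16 dvd n" "\<not> 25 dvd n"
    using nd[of 9] nd[of 15] nd[of 20] nd[of 24] nd[of 16] nd[of 25] t15 t20 t24 t16 t25
    by auto
  have pr: "p \<in> {2, 3, 5}" if "prime p" "p dvd n" for p
  proof -
    have "p - 1 < 6" using nd[OF _ , of p] that totient_prime[of p] by force
    then have "p \<in> {2, 3, 4, 5, 6}" using prime_ge_2_nat[OF that(1)] by auto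
    moreover have "\<not> prime (4::nat)" "\<not> prime (6::nat)" by simp_all
    ultimately show ?thesis using that(1) by auto
  qed
  \<comment> \<open>The odd part of n: as 9, 15 and 25 do not divide n, it is 1, 3 or 5, and the
    cofactor is a power of 2.\<close>
  define m where "m = (if 3 dvd n then 3 else if 5 dvd n then 5 else 1 :: nat)"
  have "m dvd n" by (simp add: m_def)
  then obtain k where k: "n = m * k" by blast
  have k0: "k > 0" using assms(1) k by (intro Nat.gr0I) auto
  have k2: "p = 2" if "prime p" "p dvd k" for p
  proof -
    have "p dvd n" using that k by simp
    then have "p \<in> {2, 3, 5}" using pr that by blast
    moreover have "\<not> 3 dvd k" if "m = 3"
      using ndv(1) k that mult_dvd_mono[OF dvd_refl[of 3], of 3 k] by auto
    moreover have "\<not> 5 dvd k" if "m = 3"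
      using ndv(2) k that mult_dvd_mono[OF dvd_refl[of 3], of 5 k] by auto
    moreover have "\<not> 5 dvd k" if "m = 5"
      using ndv(6) k that mult_dvd_mono[OF dvd_refl[of 5], of 5 k] by auto
    moreover have "m = 3" if "3 dvd n" using that by (simp add: m_def)
    moreover have "m = 3 \<or> m = 5" if "5 dvd n" using that by (simp add: m_def)
    ultimately show ?thesis using \<open>p dvd n\<close> \<open>p dvd k\<close> by blast
  qed
  obtain y where y: "k = 2 ^ multiplicity 2 k * y" "\<not> 2 dvd y"
    using multiplicity_decompose'[of k 2] k0 by auto
  have "y = 1"
  proof (rule ccontr)
    assume "y \<noteq> 1"
    then obtain p where "prime p" "p dvd y" using prime_factor_nat by blast
    then show False using k2[of p] y by (metis dvd_mult)
  qed
  define a where "a = multiplicity 2 k"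
  have a: "n = m * 2 ^ a" using k y \<open>y = 1\<close> by (simp add: a_def)
  have dv: "m * 2 ^ b dvd n" if "b \<le> a" for b
    unfolding a using that by (intro mult_dvd_mono le_imp_power_dvd dvd_refl)
  have "\<not> 4 \<le> a"
  proof
    assume "4 \<le> a"
    then have "m * 2 ^ 4 dvd n" by (rule dv)
    then have "16 dvd n" by (auto dest: dvd_mult_right)
    then show False using ndv(5) by contradiction
  qed
  moreover have "\<not> 3 \<le> a" if "m = 3"
  proof
    assume "3 \<le> a"
    then have "m * 2 ^ 3 dvd n" by (rule dv)
    then show False using ndv(4) that by simp
  qed
  moreover have "\<not> 2 \<le> a" if "m = 5"
  proof
    assume "2 \<le> a"
    then have "m * 2 ^ 2 dvd n" by (rule dv)
    then show False using ndv(3) that by simp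
  qed
  moreover have "\<not> 4 \<le> a \<Longrightarrow> a \<in> {0, 1, 2, 3}" by auto
  moreover have "m \<in> {1, 3, 5}" by (simp add: m_def)
  ultimately have "a \<in> {0, 1, 2, 3} \<and> m = 1 \<or> a \<in> {0, 1, 2} \<and> m = 3 \<or> a \<in> {0, 1} \<and> m = 5"
    by auto
  then have "n \<in> {1, 2, 4, 8, 3, 6, 12, 5, 10}" unfolding a by auto
  then show False using assms by auto
qed

section \<open>Rank of apparition and valuations\<close>

text \<open>Modulo p both V_m and V_n are 2, so r = V_(n+m) and s = V_(n-m) have sum 4 and product
  4. Hence (s - 2)^2 = 0 modulo p, and primality removes the square.\<close>

lemma prime_dvd_lp_seq_diff:
  assumes "p dvd lp_seq t m" "p dvd lp_seq t n" "m \<le> n" "prime p"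
  shows "p dvd lp_seq t (n - m)"
proof -
  define a b r s where "a = lp_seq t n" and "b = lp_seq t m"
    and "r = trace_seq t (n + m)" and "s = trace_seq t (n - m)"
  have V: "trace_seq t n = a + 2" "trace_seq t m = b + 2" by (simp_all add: a_def b_def lp_seq_def)
  have sum: "r + s = (a + 2) * (b + 2)"
    using trace_seq_add'[OF assms(3), of t] by (simp add: r_def s_def V)
  have "n + m + (n - m) = 2 * n" "n + m - (n - m) = 2 * m" using assms(3) by simp_all
  then have prod: "r * s = (a + 2)\<^sup>2 + (b + 2)\<^sup>2 - 4"
    using trace_seq_add'[of "n - m" "n + m" t] trace_seq_double[of t n] trace_seq_double[of t m]
    by (simp only: V flip: r_def s_def) simp
  have "(s - 2)\<^sup>2 = s * (r + s) - r * s - 4 * s + 4"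
    by (simp add: power2_eq_square algebra_simps)
  also have "\<dots> = a * (s * b + 2 * s - a - 4) + b * (2 * s - b - 4)"
    unfolding sum prod by (simp add: power2_eq_square algebra_simps)
  finally have "p dvd (s - 2)\<^sup>2" using assms(1,2) by (simp add: a_def b_def)
  then show ?thesis using assms(4) by (simp add: s_def lp_seq_def prime_dvd_power_iff)
qed

definition lp_rank :: "int \<Rightarrow> nat \<Rightarrow> nat" where
  "lp_rank t p = (LEAST m. m > 0 \<and> int p dvd lp_seq t m)"

context
  fixes t :: int and p :: nat
  assumes t: "t \<ge> 3" and p: "prime p"
begin

lemma dvd_lp_seq_neighbour: "int p dvd lp_seq t (p - 1) \<or> int p dvd lp_seq t (p + 1)"
proof -
  have "Suc (p - 1) = p" using prime_gt_0_nat[OF p] by simp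
  then have "lp_seq t (p + 1) * lp_seq t (p - 1) = (trace_seq t p - t)\<^sup>2"
    using lp_seq_neighbours[of t "p - 1"] by simp
  moreover have "int p dvd (trace_seq t p - t)\<^sup>2"
    using trace_seq_prime_cong[OF p t] by (simp add: power2_eq_square)
  ultimately show ?thesis using p prime_dvd_mult_iff[of "int p"] by (metis prime_nat_int_transfer)
qed

lemma lp_rank: "lp_rank t p > 0" "int p dvd lp_seq t (lp_rank t p)"
proof -
  have "\<exists>m. m > 0 \<and> int p dvd lp_seq t m"
    using dvd_lp_seq_neighbour prime_gt_1_nat[OF p] by (metis add_gr_0 zero_less_diff zero_less_one)
  then have "lp_rank t p > 0 \<and> int p dvd lp_seq t (lp_rank t p)"
    unfolding lp_rank_def by (rule LeastI_ex)
  then show "lp_rank t p > 0" "int p dvd lp_seq t (lp_rank t p)" by blast+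
qed

text \<open>The indices n with p | D_n are closed under differences, so a nonzero remainder of n
  modulo the rank would contradict minimality.\<close>

lemma lp_rank_dvd_iff: "lp_rank t p dvd n \<longleftrightarrow> int p dvd lp_seq t n"
proof
  assume "lp_rank t p dvd n"
  then show "int p dvd lp_seq t n" using lp_rank(2) lp_seq_dvd dvd_trans by blast
next
  assume n: "int p dvd lp_seq t n"
  define z where "z = lp_rank t p"
  have "int p dvd lp_seq t (z * (n div z))" using lp_rank(2) lp_seq_dvd_mult dvd_trans unfolding z_def by blast
  moreover have "z * (n div z) \<le> n" by simp
  ultimately have "int p dvd lp_seq t (n - z * (n div z))"
    using n p by (intro prime_dvd_lp_seq_diff) auto
  then have "int p dvd lp_seq t (n mod z)" by (simp add: minus_mult_div_eq_mod)
  moreover have "n mod z < z" using lp_rank(1) by (simp add: z_def)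
  ultimately have "n mod z = 0" unfolding z_def lp_rank_def by (metis (mono_tags, lifting) not_less_Least not_gr_zero)
  then show "lp_rank t p dvd n" by (auto simp: z_def)
qed

lemma lp_rank_cases: "lp_rank t p dvd p - 1 \<or> lp_rank t p dvd p + 1"
  using dvd_lp_seq_neighbour by (simp add: lp_rank_dvd_iff)

lemma lp_rank_le: "lp_rank t p \<le> p + 1"
  using lp_rank_cases prime_gt_1_nat[OF p] by (auto dest: dvd_imp_le)

text \<open>With x = D_m, the expansion gives D_(mk) = x (k^2 + x y), and p divides x but not
  k^2.\<close>

lemma multiplicity_lp_seq_coprime:
  assumes "int p dvd lp_seq t m" "m > 0" "\<not> p dvd k"
  shows "multiplicity (int p) (lp_seq t (m * k)) = multiplicity (int p) (lp_seq t m)"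
proof -
  define x where "x = lp_seq t m"
  have tx: "trace_seq t m - 2 = x" by (simp add: x_def lp_seq_def)
  have x0: "x \<noteq> 0" using lp_seq_pos[OF t assms(2)] by (simp add: x_def)
  obtain y where "lp_seq t (m * k) - (int k)\<^sup>2 * x = x\<^sup>2 * y"
    using lp_seq_cong[of "trace_seq t m" k] by (auto simp: tx lp_seq_mult elim: dvdE)
  then have eq: "lp_seq t (m * k) = x * ((int k)\<^sup>2 + x * y)"
    by (simp add: power2_eq_square algebra_simps)
  have "\<not> int p dvd (int k)\<^sup>2" using assms(3) p by (simp add: prime_dvd_power_iff)
  then have nd: "\<not> int p dvd (int k)\<^sup>2 + x * y" using assms(1) by (simp add: dvd_add_left_iff x_def)
  then show ?thesis unfolding eq using p x0
    by (subst prime_elem_multiplicity_mult_distrib) (auto simp: not_dvd_imp_multiplicity_0 x_def)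
qed

text \<open>With x = D_m, D_(mp) is x (x + 4) for p = 2 and x B^2 for odd p. The new factor has
  valuation 2: for p = 2 because x + 4 is 4 modulo 8, for odd p because B is p modulo p^2.\<close>

lemma multiplicity_lp_seq_prime:
  assumes "int p dvd lp_seq t m" "m > 0"
    and "p = 2 \<Longrightarrow> 8 dvd lp_seq t m" "p = 3 \<Longrightarrow> 9 dvd lp_seq t m"
  shows "multiplicity (int p) (lp_seq t (m * p)) = multiplicity (int p) (lp_seq t m) + 2"
proof -
  define x where "x = lp_seq t m"
  have tx: "trace_seq t m - 2 = x" by (simp add: x_def lp_seq_def)
  have x0: "x > 0" using lp_seq_pos[OF t assms(2)] by (simp add: x_def)
  show ?thesis
  proof (cases "p = 2")
    case True
    then obtain y where y: "x = 8 * y" using assms(3) by (auto simp: x_def)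
    have "\<not> 8 dvd x + 4" "4 dvd x + 4" unfolding y by presburger+
    then have "multiplicity 2 (x + 4) = 2" by (intro multiplicity_eqI) simp_all
    moreover have "lp_seq t (m * p) = x * (x + 4)"
      using lp_seq_double[of t m] True by (simp add: mult.commute x_def)
    ultimately show ?thesis using x0 True
      by (simp add: prime_elem_multiplicity_mult_distrib flip: x_def)
  next
    case False
    then have "odd p" using p prime_odd_nat prime_ge_2_nat by (metis le_neq_implies_less)
    then obtain j where j: "p = 2 * j + 1" by (elim oddE)
    obtain B where B: "lp_seq t (m * p) = x * B\<^sup>2"
      "x\<^sup>2 dvd 6 * B - (2 * int j + 1) * (6 + int j * (int j + 1) * x)"
      using lp_seq_odd[of "trace_seq t m" j] x0 tx unfolding lp_seq_mult j by auto
    obtain y where y: "x = int p * y" using assms(1) by (auto simp: x_def)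
    \<comment> \<open>As p divides x, the error x^2 and the term p j (j + 1) x vanish modulo p^2,
      leaving 6 B = 6 p.\<close>
    have "(int p)\<^sup>2 dvd 6 * B - int p * (6 + int j * (int j + 1) * x)"
      using B(2) y by (metis (no_types, lifting) dvd_trans dvd_triv_left j of_nat_1 of_nat_add
          of_nat_mult of_nat_numeral power_mult_distrib)
    then have "(int p)\<^sup>2 dvd (6 * B - int p * (6 + int j * (int j + 1) * x)) + (int p)\<^sup>2 * (int j * (int j + 1) * y)"
      by simp
    also have "\<dots> = 6 * (B - int p)" unfolding y by (simp add: power2_eq_square algebra_simps)
    finally have dvd6: "(int p)\<^sup>2 dvd 6 * (B - int p)" .
    have "(int p)\<^sup>2 dvd B - int p"
    proof (cases "p = 3")
      case True
      then obtain w where w: "x = 9 * w" using assms(4) by (auto simp: x_def)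
      \<comment> \<open>Cancelling 6 costs a power of 3, so for p = 3 the congruence is taken modulo
        81, which 9 | x allows.\<close>
      have "81 dvd x\<^sup>2" unfolding w by (simp add: power2_eq_square)
      then have "81 dvd 6 * B - 3 * (6 + 2 * x)" using B(2) True j dvd_trans by force
      then have "9 dvd B - 3" unfolding w by presburger
      then show ?thesis using True by simp
    next
      case False
      have "coprime (int p) 2" "coprime (int p) 3"
        using p False \<open>odd p\<close> by (auto intro!: primes_coprime)
      then have "coprime (int p) (2 * 3)" by (simp only: coprime_mult_right_iff)
      then have "coprime ((int p)\<^sup>2) 6" by simp
      then show ?thesis using dvd6 coprime_dvd_mult_right_iff by blast
    qed
    then obtain w where "B - int p = (int p)\<^sup>2 * w" ..
    then have w: "B = int p * (1 + int p * w)" by (simp add: power2_eq_square algebra_simps)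
    have nd: "\<not> int p dvd 1 + int p * w" using prime_gt_1_nat[OF p] by (simp add: dvd_add_left_iff)
    then have "multiplicity (int p) B = 1" unfolding w using p
      by (subst prime_elem_multiplicity_mult_distrib) (auto simp: not_dvd_imp_multiplicity_0)
    moreover have "B \<noteq> 0" using lp_seq_pos[OF t, of "m * p"] B assms(2) prime_gt_0_nat[OF p] by auto
    ultimately show ?thesis unfolding B(1) using x0 p
      by (simp add: prime_elem_multiplicity_mult_distrib prime_elem_multiplicity_power_distrib flip: x_def)
  qed
qed

text \<open>At the indices 2, 4, 6 for \<open>p = 2\<close> and 3, 6 for \<open>p = 3\<close> the increment can differ from 2.\<close>
lemma multiplicity_lp_seq_rank_power:
  assumes n: "lp_rank t p * p ^ Suc j > 6"
  shows "multiplicity (int p) (lp_seq t (lp_rank t p * p ^ Suc j)) =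
    multiplicity (int p) (lp_seq t (lp_rank t p * p ^ j)) + 2"
proof -
  define z m where "z = lp_rank t p" and "m = z * p ^ j"
  have z: "z > 0" "int p dvd lp_seq t z" using lp_rank by (auto simp: z_def)
  have "m > 0" using z prime_gt_0_nat[OF p] by (simp add: m_def)
  have pm: "int p dvd lp_seq t m" using z(2) lp_seq_dvd_mult dvd_trans unfolding m_def by blast
  have n': "z * p ^ Suc j > 6" using n by (simp only: z_def)
  have "8 dvd lp_seq t m" if [simp]: "p = 2"
  proof -
    have "z dvd 1 \<or> z dvd 3" using lp_rank_cases by (simp add: z_def)
    moreover have "z = 1 \<or> z = 3" if "z dvd 3"
      using that prime_nat_iff[of 3] by simp
    ultimately consider "z = 1" | "z = 3" by auto
    then show ?thesis
    proof cases
      \<comment> \<open>Rank 1: t is even, which yields 8 | D_4, and n > 6 forces m = 2^j to be a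
        multiple of 4.\<close>
      case 1
      have "2 dvd t - 2" using z 1 by simp
      then obtain a where a: "t - 2 = 2 * a" ..
      have "lp_seq t 2 = 4 * (a * (a + 2))" using lp_seq_double[of t 1] a by simp
      then have "lp_seq t 4 = 8 * (2 * (a * (a + 2)) * (a * (a + 2) + 1))"
        using lp_seq_double[of t 2] by (simp add: algebra_simps)
      then have "8 dvd lp_seq t 4" by simp
      moreover have "j \<ge> 2"
      proof (rule ccontr)
        assume "\<not> j \<ge> 2"
        then have "2 ^ Suc j \<le> (2::nat) ^ 2" by (intro power_increasing) auto
        then show False using n' unfolding 1 that by simp
      qed
      then have "4 dvd m" using le_imp_power_dvd[of 2 j "2::nat"] by (simp add: m_def 1)
      ultimately show ?thesis using lp_seq_dvd dvd_trans by blast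
    next
      \<comment> \<open>Rank 3: t is odd, so 4 | D_3 and 8 | D_6, and n > 6 forces j > 0, hence 6 |
        m.\<close>
      case 2
      have "\<not> int p dvd lp_seq t 1" using lp_rank_dvd_iff[of 1] 2 unfolding z_def[symmetric] by simp
      then have "2 dvd t + 1" by simp
      then obtain a where a: "t = 2 * a - 1" by (metis add_diff_cancel dvdE)
      have "lp_seq t 3 = (t - 2) * (t + 1)\<^sup>2"
        by (simp add: lp_seq_def eval_nat_numeral algebra_simps)
      also have "\<dots> = 4 * ((t - 2) * a\<^sup>2)" unfolding a by (simp add: power2_eq_square)
      finally have "4 dvd lp_seq t 3" by simp
      then obtain e where "lp_seq t 3 = 4 * e" ..
      then have "lp_seq t 6 = 8 * (2 * e * (e + 1))"
        using lp_seq_double[of t 3] by (simp add: algebra_simps)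
      then have "8 dvd lp_seq t 6" by simp
      moreover have "j > 0" using n' 2 by (intro Nat.gr0I) auto
      then have "6 dvd m" using mult_dvd_mono[of 3 3 2 "2 ^ j"] by (simp add: m_def 2)
      ultimately show ?thesis using lp_seq_dvd dvd_trans by blast
    qed
  qed
  moreover have "9 dvd lp_seq t m" if [simp]: "p = 3"
  proof (cases j)
    \<comment> \<open>One tripling already gives 9, since D_(3z) = D_z (D_z + 3)^2 with 3 |
      D_z.\<close>
    case (Suc i)
    have "lp_seq t (z * 3) = lp_seq t z * (lp_seq t z + 3)\<^sup>2"
      unfolding lp_seq_mult[of t z 3]
      by (simp add: lp_seq_def eval_nat_numeral algebra_simps)
    moreover obtain a where "lp_seq t z = 3 * a" using z by auto
    ultimately have "lp_seq t (z * 3) = 9 * (3 * a * (a + 1)\<^sup>2)"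
      by (simp add: power2_eq_square algebra_simps)
    moreover have "z * 3 dvd m" by (simp add: m_def Suc)
    ultimately show ?thesis using lp_seq_dvd dvd_trans by (metis dvd_triv_left)
  next
    \<comment> \<open>Now 3 z > 6, and the rank divides 2 or 4, so z = 4. Then D_4 = D_2 t^2 with 3
      not dividing D_2, so 3 | t and 9 | D_4.\<close>
    case 0
    have "z \<le> 4" using lp_rank_le by (simp add: z_def)
    moreover have "z dvd 2 \<or> z dvd 4" using lp_rank_cases by (simp add: z_def)
    then have "z \<noteq> 3" by auto
    moreover have "z > 2" using n' 0 by simp
    ultimately have z4: "z = 4" by auto
    have "\<not> 3 dvd lp_seq t 2" using lp_rank_dvd_iff[of 2] z4 unfolding z_def[symmetric] by auto
    have "lp_seq t 2 + 4 = t\<^sup>2" by (simp add: lp_seq_def numeral_2_eq_2)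
    then have eq: "lp_seq t 4 = lp_seq t 2 * t\<^sup>2" using lp_seq_double[of t 2] by simp
    then have "3 dvd lp_seq t 2 * t\<^sup>2" using z(2) z4 by simp
    then have "3 dvd t\<^sup>2" using \<open>\<not> 3 dvd lp_seq t 2\<close> by (subst (asm) prime_dvd_mult_iff) auto
    then have "3 dvd t" by (simp add: prime_dvd_power_iff)
    then have "9 dvd t\<^sup>2" using mult_dvd_mono[of 3 t 3 t] by (simp add: power2_eq_square)
    then show ?thesis unfolding m_def 0 using z4 eq by simp
  qed
  ultimately show ?thesis using multiplicity_lp_seq_prime[OF pm \<open>m > 0\<close>]
    by (simp add: m_def z_def mult_ac)
qed

text \<open>On the divisors of n the valuation is a combination of the indicators of z p^j | d, with
  the increments along z, z p, z p^2, ... as coefficients. Inversion keeps the increment with z p^j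
  = n; there j > 0, and this increment is 2.\<close>

lemma moebius_sum_multiplicity:
  assumes n: "n > 6" and nz: "lp_rank t p \<noteq> n"
  shows "(\<Sum>d | d dvd n. moebius (n div d) * int (multiplicity (int p) (lp_seq t d))) =
    (if \<exists>j. n = lp_rank t p * p ^ j then 2 else 0)"
proof -
  define z v where "z = lp_rank t p" and "v = (\<lambda>d. int (multiplicity (int p) (lp_seq t d)))"
  \<comment> \<open>The start value and the successive increments, so that partial sums telescope to
    the valuation at z p^k.\<close>
  define c where "c = (\<lambda>j. case j of 0 \<Rightarrow> v z | Suc i \<Rightarrow> v (z * p ^ Suc i) - v (z * p ^ i))"
  have z: "z > 0" "int p dvd lp_seq t z" using lp_rank by (auto simp: z_def)
  have p1: "p > 1" using p by (rule prime_gt_1_nat)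
  have sum_c: "(\<Sum>j\<le>k. c j) = v (z * p ^ k)" for k
    by (induction k) (auto simp: c_def)
  have v_eq: "v d = (\<Sum>j\<le>n. if z * p ^ j dvd d then c j else 0)" if d: "d dvd n" for d
  proof (cases "z dvd d")
    case False
    then have "\<not> int p dvd lp_seq t d" by (simp add: lp_rank_dvd_iff z_def)
    then have "v d = 0" by (simp add: v_def not_dvd_imp_multiplicity_0)
    moreover have "\<not> z * p ^ j dvd d" for j using False dvd_mult_left by blast
    ultimately show ?thesis by simp
  next
    case True
    then obtain e where e: "d = z * e" ..
    have "d > 0" using d n by (auto intro!: Nat.gr0I)
    then have "e > 0" using e by (auto intro!: Nat.gr0I)
    define k where "k = multiplicity p e"
    obtain y where y: "e = p ^ k * y" "\<not> p dvd y"
      unfolding k_def using multiplicity_decompose'[of e p] \<open>e > 0\<close> p1 by (auto simp: k_def)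
    \<comment> \<open>The crude bound k <= n lets one fixed range of exponents serve all divisors
      d.\<close>
    have "k < p ^ k" using p1 by (intro power_gt_expt) simp
    also have "p ^ k \<le> n"
      using d n e y by (intro dvd_imp_le) (auto intro: dvd_trans[of _ "z * (p ^ k * y)"])
    finally have "k \<le> n" by simp
    have "z * p ^ j dvd d \<longleftrightarrow> j \<le> k" for j
      using z(1) \<open>e > 0\<close> p1 unfolding e by (simp add: power_dvd_iff_le_multiplicity k_def)
    then have "(\<Sum>j\<le>n. if z * p ^ j dvd d then c j else 0) = (\<Sum>j\<in>{j\<in>{..n}. j \<le> k}. c j)"
      by (subst sum.inter_filter) auto
    also have "{j\<in>{..n}. j \<le> k} = {..k}" using \<open>k \<le> n\<close> by auto
    finally have "(\<Sum>j\<le>n. if z * p ^ j dvd d then c j else 0) = v (z * p ^ k)" by (simp only: sum_c)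
    moreover have "v d = v (z * p ^ k)"
    proof -
      have "int p dvd lp_seq t (z * p ^ k)" using z(2) lp_seq_dvd_mult dvd_trans by blast
      then show ?thesis unfolding e y v_def mult.assoc[symmetric]
        using multiplicity_lp_seq_coprime y z p1 by simp
    qed
    ultimately show ?thesis by simp
  qed
  have fin: "finite {d. d dvd n}" using n by simp
  have "(\<Sum>d | d dvd n. moebius (n div d) * v d) =
      (\<Sum>d | d dvd n. \<Sum>j\<le>n. c j * (if z * p ^ j dvd d then moebius (n div d) else 0))"
    by (intro sum.cong refl) (auto simp: v_eq sum_distrib_left intro!: sum.cong)
  also have "\<dots> = (\<Sum>j\<le>n. \<Sum>d | d dvd n. c j * (if z * p ^ j dvd d then moebius (n div d) else 0))"
    by (rule sum.swap)
  also have "\<dots> = (\<Sum>j\<le>n. c j * (if z * p ^ j = n then 1 else 0))"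
  proof (intro sum.cong refl)
    fix j
    have "(\<Sum>d | d dvd n. if z * p ^ j dvd d then moebius (n div d) else 0) =
        (\<Sum>d | d dvd n \<and> z * p ^ j dvd d. moebius (n div d))"
      using fin by (subst sum.inter_filter[symmetric]) auto
    then show "(\<Sum>d | d dvd n. c j * (if z * p ^ j dvd d then moebius (n div d) else 0)) =
        c j * (if z * p ^ j = n then 1 else 0)"
      using sum_moebius_multiples[of n "z * p ^ j"] n by (simp flip: sum_distrib_left)
  qed
  also have "\<dots> = (if \<exists>j. n = z * p ^ j then 2 else 0)"
  proof (cases "\<exists>j. n = z * p ^ j")
    case True
    then obtain j where j: "n = z * p ^ j" ..
    have "j < p ^ j" using p1 by (intro power_gt_expt) simp
    also have "p ^ j \<le> n" using j z by simp
    finally have "j \<le> n" by simp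
    have eq: "z * p ^ i = n \<longleftrightarrow> i = j" for i using z p1 unfolding j by auto
    have "(\<Sum>i\<le>n. c i * (if z * p ^ i = n then 1 else 0)) = c j"
      unfolding eq using \<open>j \<le> n\<close> by (simp add: if_distrib[of "\<lambda>x. _ * x"] cong: if_cong)
    moreover obtain i where "j = Suc i" using j nz by (cases j) (auto simp: z_def)
    then have "c j = 2" using multiplicity_lp_seq_rank_power[of i] n j
      by (simp add: c_def v_def flip: z_def)
    ultimately show ?thesis using True by simp
  next
    case False
    then have "z * p ^ i \<noteq> n" for i by metis
    then show ?thesis using False by simp
  qed
  finally show ?thesis by (simp add: z_def v_def)
qed

end

section \<open>The primitive part\<close>

lemma ln_nat_prime_factorization:
  assumes "N > 0" "prime_factors N \<subseteq> P" "finite P" "\<And>p. p \<in> P \<Longrightarrow> prime p"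
  shows "ln (real N) = (\<Sum>p\<in>P. real (multiplicity p N) * ln (real p))"
proof -
  have "real N = real (\<Prod>p\<in>prime_factors N. p ^ multiplicity p N)"
    using assms(1) prod_prime_factors[of N] by simp
  also have "\<dots> = (\<Prod>p\<in>prime_factors N. real p ^ multiplicity p N)" by simp
  also have "ln \<dots> = (\<Sum>p\<in>prime_factors N. ln (real p ^ multiplicity p N))"
    by (intro ln_prod) (auto dest!: in_prime_factors_imp_prime prime_gt_0_nat)
  also have "\<dots> = (\<Sum>p\<in>prime_factors N. real (multiplicity p N) * ln (real p))"
    by (intro sum.cong refl ln_realpow)
  also have "\<dots> = (\<Sum>p\<in>P. real (multiplicity p N) * ln (real p))"
    using assms by (intro sum.mono_neutral_left) (auto simp: prime_factors_multiplicity)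
  finally show ?thesis .
qed

lemma multiplicity_int_of_nat: "prime p \<Longrightarrow> multiplicity (int p) (int N) = multiplicity p N"
proof (cases "N = 0")
  case False
  assume p: "prime p"
  have "\<not> is_unit p" using p by auto
  then show ?thesis using False
    by (intro multiplicity_eqI)
      (auto simp: multiplicity_dvd power_dvd_iff_le_multiplicity simp flip: of_nat_power of_nat_Suc power_Suc)
qed simp

section \<open>Two evaluations of the Moebius sum of logarithms\<close>

context
  fixes t :: int
  assumes t: "t \<ge> 3"
begin

definition "moebius_log_sum n = (\<Sum>d | d dvd n. real_of_int (moebius (n div d)) * ln (real_of_int (lp_seq t d)))"

text \<open>With x = 1/u, D_d = u^d (1 - x^d)^2. The powers of u add up to the totient term. The
  logarithms of 1 - x^d are negative and their coefficients at most 1, so raising every coefficient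
  to 1 and then summing over all d up to n only lowers the sum.\<close>

lemma moebius_log_sum_ge:
  fixes u :: real
  assumes n: "n > 0" and u: "u > 1" "u + 1 / u = of_int t"
  shows "moebius_log_sum n \<ge> real (totient n) * ln u + 2 * ln (1 - 1 / u - (1 / u)\<^sup>2)"
proof -
  define x where "x = 1 / u"
  have ux: "u * x = 1" "u + x = of_int t" using u by (auto simp: x_def)
  have x1: "0 < x" "x < 1" using u by (auto simp: x_def)
  \<comment> \<open>From u = t - x with x < 1; then x < 1/2, which makes 1 - x - x^2
    positive.\<close>
  have "u > 2" using ux(2) x1 t by linarith
  then have x: "x < 1 / 2" by (simp add: x_def field_simps)
  have xp: "0 < 1 - x ^ d" "1 - x ^ d < 1" if "d > 0" for d
    using x1 that by (auto simp: power_less_one_iff)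
  have lnD: "ln (real_of_int (lp_seq t d)) = d * ln u + 2 * ln (1 - x ^ d)" if "d > 0" for d
  proof -
    have "real_of_int (lp_seq t d) = u ^ d + x ^ d - 2"
      using trace_seq_closed_form[OF ux, of d] by (simp add: lp_seq_def)
    also have "\<dots> = u ^ d + (u * x) ^ d * x ^ d - 2 * (u * x) ^ d" using ux by simp
    also have "\<dots> = u ^ d * (1 - x ^ d)\<^sup>2"
      by (simp add: power_mult_distrib power2_eq_square algebra_simps)
    finally show ?thesis using u xp[OF that] by (simp add: ln_mult ln_realpow)
  qed
  have fin: "finite {d. d dvd n}" using n by simp
  have "moebius_log_sum n = (\<Sum>d | d dvd n. real_of_int (moebius (n div d) * int d) * ln u
      + 2 * (real_of_int (moebius (n div d)) * ln (1 - x ^ d)))"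
    unfolding moebius_log_sum_def
  proof (intro sum.cong refl)
    fix d assume "d \<in> {d. d dvd n}"
    then have "d > 0" using n by (auto intro!: Nat.gr0I)
    then show "real_of_int (moebius (n div d)) * ln (real_of_int (lp_seq t d)) =
        real_of_int (moebius (n div d) * int d) * ln u
        + 2 * (real_of_int (moebius (n div d)) * ln (1 - x ^ d))"
      by (simp add: lnD algebra_simps)
  qed
  also have "\<dots> = real_of_int (\<Sum>d | d dvd n. moebius (n div d) * int d) * ln u
      + 2 * (\<Sum>d | d dvd n. real_of_int (moebius (n div d)) * ln (1 - x ^ d))"
    by (simp add: sum.distrib sum_distrib_left sum_distrib_right)
  also have "\<dots> = real (totient n) * ln u + 2 * (\<Sum>d | d dvd n. real_of_int (moebius (n div d)) * ln (1 - x ^ d))"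
    by (simp only: sum_moebius_totient[OF n] of_int_of_nat_eq)
  finally have eq: "moebius_log_sum n = real (totient n) * ln u +
    2 * (\<Sum>d | d dvd n. real_of_int (moebius (n div d)) * ln (1 - x ^ d))" .
  have "ln (1 - x - x\<^sup>2) \<le> ln (\<Prod>d=1..n. 1 - x ^ d)"
  proof (rule ln_mono)
    have "x * x < (1 / 2) * (1 / 2)" using x x1 by (intro mult_strict_mono) auto
    then show "0 < 1 - x - x\<^sup>2" using x by (simp add: power2_eq_square)
    obtain m where "n = Suc m" using n gr0_implies_Suc by blast
    then have "(\<Prod>d=1..n. 1 - x ^ d) \<ge> 1 - x - x\<^sup>2 + x ^ (m + 2)"
      using prod_one_minus_power_ge[of x m] x1 by simp
    moreover have "x ^ (m + 2) > 0" using x1 by simp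
    ultimately show "1 - x - x\<^sup>2 \<le> (\<Prod>d=1..n. 1 - x ^ d)" by linarith
  qed
  also have "\<dots> = (\<Sum>d=1..n. ln (1 - x ^ d))"
  proof (intro ln_prod)
    show "finite {1..n}" by simp
  next
    fix d assume "d \<in> {1..n}"
    then show "1 - x ^ d \<noteq> 0" using xp(1)[of d] by simp
  qed
  also have "\<dots> \<le> (\<Sum>d | d dvd n. ln (1 - x ^ d))"
  proof -
    have "(\<Sum>d | d dvd n. - ln (1 - x ^ d)) \<le> (\<Sum>d=1..n. - ln (1 - x ^ d))"
    proof (rule sum_mono2)
      show "{d. d dvd n} \<subseteq> {1..n}"
      proof
        fix d assume "d \<in> {d. d dvd n}"
        then show "d \<in> {1..n}" using n dvd_imp_le[of d n] by (cases d) auto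
      qed
      fix d assume "d \<in> {1..n} - {d. d dvd n}"
      then show "0 \<le> - ln (1 - x ^ d)" using xp[of d] by simp
    qed simp
    then show ?thesis by (simp add: sum_negf)
  qed
  also have "\<dots> \<le> (\<Sum>d | d dvd n. real_of_int (moebius (n div d)) * ln (1 - x ^ d))"
  proof (intro sum_mono)
    fix d assume "d \<in> {d. d dvd n}"
    then have "d > 0" using n by (auto intro!: Nat.gr0I)
    then have "ln (1 - x ^ d) \<le> 0" using xp by (simp add: less_imp_le)
    moreover have "moebius (n div d) \<le> 1" using abs_moebius_le_1[of "n div d"] by linarith
    then have "real_of_int (moebius (n div d)) \<le> 1" by simp
    ultimately show "ln (1 - x ^ d) \<le> real_of_int (moebius (n div d)) * ln (1 - x ^ d)"
      using mult_right_mono_neg[of "real_of_int (moebius (n div d))" 1 "ln (1 - x ^ d)"] by simp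
  qed
  finally show ?thesis unfolding eq x_def by simp
qed

text \<open>Factor each D_d over the primes of D_n and exchange the sums: only primes with n = z(p)
  p^j survive, each giving 2 ln p. \<open>P\<close> is the product of the surviving primes.\<close>

lemma moebius_log_sum_eq:
  assumes n: "n > 6" and np: "\<not> (\<exists>p. primitive_prime_divisor (lp_seq t) n p)"
  shows "\<exists>P. moebius_log_sum n = 2 * ln (real P) \<and> (P = 1 \<or> prime P \<and> P dvd n \<or> P = 6 \<and> 6 dvd n)"
proof -
  define N where "N = (\<lambda>d. nat (lp_seq t d))"
  have pos: "lp_seq t d > 0" if "d dvd n" for d
    using that n by (intro lp_seq_pos t) (auto intro!: Nat.gr0I)
  have N: "lp_seq t d = int (N d)" if "d dvd n" for d using pos[OF that] by (simp add: N_def)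
  define PF where "PF = prime_factors (N n)"
  have "N n > 0" using pos[of n] by (simp add: N_def)
  have PF: "prime p" "int p dvd lp_seq t n" if "p \<in> PF" for p
    using that N[of n] by (auto simp: PF_def)
  \<comment> \<open>A prime whose rank is n itself would be a primitive divisor of D_n.\<close>
  have nz: "lp_rank t p \<noteq> n" if "p \<in> PF" for p
  proof
    assume "lp_rank t p = n"
    then have "primitive_prime_divisor (lp_seq t) n (int p)"
      unfolding primitive_prime_divisor_def
      using PF[OF that] lp_rank_dvd_iff[OF t PF(1)[OF that], symmetric]
      by (auto simp: nat_dvd_not_less)
    then show False using np by blast
  qed
  have fin: "finite {d. d dvd n}" using n by simp
  define S where "S = {p \<in> PF. \<exists>j. n = lp_rank t p * p ^ j}"
  have "finite PF" by (simp add: PF_def)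
  then have finS: "finite S" by (simp add: S_def)
  have "moebius_log_sum n = (\<Sum>d | d dvd n. \<Sum>p\<in>PF.
      real_of_int (moebius (n div d) * int (multiplicity (int p) (lp_seq t d))) * ln (real p))"
    unfolding moebius_log_sum_def
  proof (intro sum.cong refl)
    fix d assume d: "d \<in> {d. d dvd n}"
    then have "N d dvd N n" using lp_seq_dvd[of d n t] N[of d] N[of n] by simp
    then have "prime_factors (N d) \<subseteq> PF"
      unfolding PF_def using \<open>N n > 0\<close> by (intro dvd_prime_factors) auto
    then have "ln (real (N d)) = (\<Sum>p\<in>PF. real (multiplicity p (N d)) * ln (real p))"
      using pos[of d] d \<open>finite PF\<close> PF by (intro ln_nat_prime_factorization) (auto simp: N_def)
    also have "\<dots> = (\<Sum>p\<in>PF. real (multiplicity (int p) (lp_seq t d)) * ln (real p))"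
      using d PF(1) N multiplicity_int_of_nat by (intro sum.cong refl) simp
    finally show "real_of_int (moebius (n div d)) * ln (real_of_int (lp_seq t d)) = (\<Sum>p\<in>PF.
      real_of_int (moebius (n div d) * int (multiplicity (int p) (lp_seq t d))) * ln (real p))"
      using d N by (simp add: sum_distrib_left mult.assoc)
  qed
  also have "\<dots> = (\<Sum>p\<in>PF. real_of_int (\<Sum>d | d dvd n.
      moebius (n div d) * int (multiplicity (int p) (lp_seq t d))) * ln (real p))"
    by (subst sum.swap) (simp add: sum_distrib_right)
  also have "\<dots> = (\<Sum>p\<in>PF. if \<exists>j. n = lp_rank t p * p ^ j then 2 * ln (real p) else 0)"
    using moebius_sum_multiplicity[OF t _ n] PF(1) nz by (intro sum.cong refl) simp
  also have "\<dots> = (\<Sum>p\<in>S. 2 * ln (real p))"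
    unfolding S_def using \<open>finite PF\<close> by (subst sum.inter_filter) auto
  finally have eq: "moebius_log_sum n = (\<Sum>p\<in>S. 2 * ln (real p))" .
  have dvd: "p dvd n" if pS: "p \<in> S" for p
  proof -
    obtain j where "n = lp_rank t p * p ^ j" using pS by (auto simp: S_def)
    then show ?thesis using nz[of p] pS by (cases j) (auto simp: S_def)
  qed
  \<comment> \<open>If p < q both survive, q divides n = z(p) p^j, hence z(p), which is at most p +
    1. So p and q are consecutive primes.\<close>
  have two: "p = 2 \<and> q = 3" if pq: "p \<in> S" "q \<in> S" "p < q" for p q
  proof -
    have pr: "prime p" "prime q" using pq PF by (auto simp: S_def)
    obtain j where "n = lp_rank t p * p ^ j" using pq(1) by (auto simp: S_def)
    then have "q dvd lp_rank t p * p ^ j" using dvd[OF that(2)] by simp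
    moreover have "\<not> q dvd p ^ j"
      using pr pq(3) by (metis less_irrefl prime_dvd_power primes_dvd_imp_eq)
    ultimately have "q dvd lp_rank t p" using pr by (simp add: prime_dvd_mult_iff)
    then have "q \<le> lp_rank t p" using lp_rank(1)[OF t pr(1)] by (rule dvd_imp_le)
    then have q: "q = p + 1" using lp_rank_le[OF t pr(1)] pq(3) by simp
    have "p = 2"
    proof (rule ccontr)
      assume "p \<noteq> 2"
      then have "odd p" "odd q" using pr pq(3) prime_odd_nat prime_ge_2_nat[of p] by auto
      then show False using q by simp
    qed
    then show ?thesis using q by simp
  qed
  consider "S = {}" | p where "S = {p}" | "S = {2, 3}"
  proof (cases "S = {}")
    case False
    define p where "p = Min S"
    have p: "p \<in> S" "\<And>q. q \<in> S \<Longrightarrow> p \<le> q" using False finS by (auto simp: p_def)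
    show ?thesis
    proof (cases "S = {p}")
      case False
      then obtain q where "q \<in> S" "p < q" using p by (metis insertCI le_neq_implies_less singletonI subsetI subset_singletonD empty_iff)
      then have "p = 2" "2 \<in> S" "3 \<in> S" using two p(1) by auto
      moreover have "q = 3" if "q \<in> S" "q \<noteq> 2" for q
        using two[of 2 q] p(2)[of q] that \<open>p = 2\<close> \<open>2 \<in> S\<close> by auto
      ultimately have "S = {2, 3}" by blast
      then show ?thesis using that by blast
    qed (use that in blast)
  qed (use that in blast)
  then show ?thesis
  proof cases
    case 1
    then show ?thesis using eq by (intro exI[of _ 1]) simp
  next
    case (2 p)
    then have "prime p" "p dvd n" using PF dvd by (auto simp: S_def)
    then show ?thesis using eq 2 by (intro exI[of _ p]) simp
  next
    case 3
    have "2 dvd n" "3 dvd n" using dvd 3 by blast+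
    then have "6 dvd n" by presburger
    moreover have "ln 6 = ln (2::real) + ln 3" using ln_mult[of "2::real" 3] by simp
    ultimately show ?thesis using eq 3 by (intro exI[of _ 6]) simp
  qed
qed

text \<open>Comparing the two evaluations gives
  \<open>u ^ (totient n - 4) * w\<^sup>2 \<le> P\<^sup>2\<close>. For totient at least 6 exponential
  growth defeats every \<open>P\<close>; for n = 8, 10, 12 the totient is 4 and the inequality is
  just w <= P.\<close>

theorem lp_seq_primitive_prime_divisor:
  assumes n: "n > 6" and np: "\<not> (\<exists>p. primitive_prime_divisor (lp_seq t) n p)"
  shows "t = 3 \<and> n \<in> {10, 12}"
proof -
  define s where "s = sqrt ((real_of_int t)\<^sup>2 - 4)"
  define u where "u = (t + s) / 2"
  have t2: "(real_of_int t)\<^sup>2 \<ge> 3\<^sup>2" using t by (intro power_mono) auto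
  then have s: "s \<ge> 0" "s\<^sup>2 = t\<^sup>2 - 4" by (simp_all add: s_def)
  have u1: "u > 1" using t s by (simp add: u_def)
  have "u * (t - u) = (t\<^sup>2 - s\<^sup>2) / 4" by (simp add: u_def field_simps power2_eq_square)
  then have "u * (t - u) = 1" using s by simp
  then have u: "u + 1 / u = t" using u1 by (simp add: field_simps)
  \<comment> \<open>Bootstrapping with u = t - 1/u: a lower bound a for u improves to t -
    1/a.\<close>
  have bound: "u > c" if "1 \<le> a" "u > a" "t - 1 / a \<ge> c" for a c
  proof -
    have "1 / u < 1 / a" using that by (simp add: frac_less2)
    then show ?thesis using that u by linarith
  qed
  have u2: "u > 2" using bound[of 1 2] u1 t by simp
  have u25: "u > 5/2" using bound[of 2 "5/2"] u2 t by simp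
  have u26: "u > 13/5" using bound[of "5/2" "13/5"] u25 t by simp
  have u4: "u > 7/2" if "t \<ge> 4" using bound[of 2 "7/2"] u2 that by simp
  \<comment> \<open>The numerator of 1 - 1/u - 1/u^2 over u^2; its square brings the denominator
    u^4, hence the exponent \<open>totient n - 4\<close>.\<close>
  define w where "w = u\<^sup>2 - u - 1"
  have w_gt: "w > c\<^sup>2 - c - 1" if "u > c" "c \<ge> 1" for c
  proof -
    have "w - (c\<^sup>2 - c - 1) = (u - c) * (u + c - 1)"
      by (simp add: w_def power2_eq_square algebra_simps)
    also have "\<dots> > 0" using that by simp
    finally show ?thesis by simp
  qed
  have w3: "w > 79/25" using w_gt[OF u26] by (simp add: power2_eq_square)
  have w4: "w > 31/4" if "t \<ge> 4" using w_gt[OF u4[OF that]] by (simp add: power2_eq_square)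
  obtain P where P: "moebius_log_sum n = 2 * ln (real P)"
    "P = 1 \<or> prime P \<and> P dvd n \<or> P = 6 \<and> 6 dvd n"
    using moebius_log_sum_eq[OF n np] by blast
  have "P > 0" using P(2) prime_gt_0_nat by auto
  have xu: "1 - 1 / u - (1 / u)\<^sup>2 = w / u\<^sup>2" using u1 by (simp add: w_def field_simps power2_eq_square)
  have main: "u ^ (totient n - 4) * w\<^sup>2 \<le> (real P)\<^sup>2" if "totient n \<ge> 4"
  proof -
    have pos: "u > 0" "w / u\<^sup>2 > 0" using u1 w3 by auto
    have "ln (u ^ totient n * (w / u\<^sup>2)\<^sup>2) = real (totient n) * ln u + 2 * ln (w / u\<^sup>2)"
      using pos w3 by (simp add: ln_mult ln_realpow)
    also have "\<dots> \<le> 2 * ln (real P)"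
      using moebius_log_sum_ge[OF _ u1 u, of n] n P(1) xu by simp
    also have "\<dots> = ln ((real P)\<^sup>2)" using \<open>P > 0\<close> by (simp add: ln_realpow)
    finally have "u ^ totient n * (w / u\<^sup>2)\<^sup>2 \<le> (real P)\<^sup>2"
      using pos w3 \<open>P > 0\<close> by (subst (asm) ln_le_cancel_iff) auto
    moreover have "u ^ totient n = u ^ (totient n - 4) * u ^ 4"
      using that by (simp flip: power_add)
    ultimately show ?thesis using pos by (simp add: power_divide power_mult[symmetric] mult.assoc)
  qed
  have t10: "totient 10 = 4" using totient_mult_coprime[of 2 5] primes_coprime[of 2 "5::nat"] by simp
  have t12: "totient 12 = 4" using totient_mult_coprime[of 4 3] coprime_Suc_right_nat[of 3] by (simp add: coprime_commute)
  show ?thesis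
  proof (cases "n \<in> {8, 10, 12}")
    case False
    then have phi: "totient n \<ge> 6" using totient_ge_6 n by auto
    have w2: "w\<^sup>2 \<ge> (79/25)\<^sup>2" using w3 by (intro power_mono) auto
    have u2': "u\<^sup>2 \<ge> (13/5)\<^sup>2" using u26 by (intro power_mono) auto
    \<comment> \<open>Two powers of u are bounded by 13/5 each and k further ones by 2. The
      constants multiply to more than 67, which excludes P <= 6.\<close>
    have pow: "(13/5)\<^sup>2 * 2 ^ k * (79/25)\<^sup>2 \<le> (real P)\<^sup>2" if "k + 6 \<le> totient n" for k
    proof -
      have "(13/5)\<^sup>2 * 2 ^ k * (79/25)\<^sup>2 \<le> u\<^sup>2 * u ^ k * w\<^sup>2"
        using u2 u2' w2 w3 u26 by (intro mult_mono power_mono) auto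
      also have "u\<^sup>2 * u ^ k = u ^ (k + 2)" by (simp add: power_add power2_eq_square)
      also have "u ^ (k + 2) * w\<^sup>2 \<le> u ^ (totient n - 4) * w\<^sup>2"
        using u1 that by (intro mult_right_mono power_increasing) auto
      also have "\<dots> \<le> (real P)\<^sup>2" using main phi by simp
      finally show ?thesis .
    qed
    have "67 < (13/5)\<^sup>2 * 2 ^ 0 * (79/25::real)\<^sup>2" by (simp add: power2_eq_square)
    also have "\<dots> \<le> (real P)\<^sup>2" using pow[of 0] phi by simp
    finally have P67: "67 < P\<^sup>2" by (simp flip: of_nat_power)
    have "P \<ge> 7"
    proof (rule ccontr)
      assume "\<not> P \<ge> 7"
      then have "P\<^sup>2 \<le> 6\<^sup>2" by (intro power_mono) auto
      then show False using P67 by simp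
    qed
    then have "prime P" "P dvd n" using P(2) by auto
    \<comment> \<open>As a prime factor of n, P makes the totient at least P - 1, so with k = P - 7
      the left side exceeds 67 * 2^k, which in turn exceeds (k + 7)^2 = P^2.\<close>
    then have "P - 1 \<le> totient n" using totient_dvd_mono[of P n] n totient_prime by auto
    moreover define k where "k = P - 7"
    ultimately have "k + 6 \<le> totient n" using \<open>P \<ge> 7\<close> by simp
    have "real ((k + 7)\<^sup>2) < 67 * 2 ^ k"
    proof (induction k)
      case (Suc k)
      have "real ((Suc k + 7)\<^sup>2) \<le> 2 * real ((k + 7)\<^sup>2)"
        by (simp add: power2_eq_square algebra_simps)
      also have "\<dots> < 2 * (67 * 2 ^ k)" using Suc by linarith
      finally show ?case by simp
    qed simp
    also have "(67::real) * 2 ^ k \<le> (13/5)\<^sup>2 * 2 ^ k * (79/25)\<^sup>2" by (simp add: power2_eq_square)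
    also have "\<dots> \<le> (real P)\<^sup>2" using pow \<open>k + 6 \<le> totient n\<close> by blast
    finally show ?thesis using \<open>P \<ge> 7\<close> by (simp add: k_def)
  next
    case True
    then have "totient n = 4" using t10 t12 by auto
    then have "w\<^sup>2 \<le> (real P)\<^sup>2" using main by simp
    then have wP: "w \<le> real P" using w3 by (simp add: power2_le_iff_abs_le)
    have P6: "P \<le> 6"
    proof -
      have "P \<le> 6" if "prime P" "P dvd n"
      proof -
        \<comment> \<open>The number 120 is a common multiple of 8, 10 and 12.\<close>
        have "P dvd 2 * 2 * 2 * 3 * 5"
          using True that(2) by (auto intro: dvd_trans)
        then have "P dvd 2 \<or> P dvd 3 \<or> P dvd 5" using that(1) by (simp only: prime_dvd_mult_iff) blast
        then show ?thesis by (auto dest!: dvd_imp_le)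
      qed
      then show ?thesis using P(2) by auto
    qed
    have "t = 3"
    proof (rule ccontr)
      assume "t \<noteq> 3"
      then have "w > 31/4" using w4 t by auto
      then show False using wP P6 by simp
    qed
    moreover have "n \<noteq> 8"
    proof
      assume 8: "n = 8"
      have "P = 2" if "prime P" "P dvd n"
      proof -
        have "P dvd 2 ^ 3" using that 8 by simp
        then show ?thesis using that by (metis prime_dvd_power primes_dvd_imp_eq two_is_prime_nat)
      qed
      then have "P \<le> 2" using P(2) 8 by auto
      then show False using w3 wP by simp
    qed
    ultimately show ?thesis using True by auto
  qed
qed

end

section \<open>The norm in a real quadratic field\<close>

text \<open>Write x + y = A/B in lowest terms. The scaled power sums W_n = B^n (x^n + y^n) are
  integers, congruent to A^n modulo B for n > 0. Multiplying p(x) + p(y) = 0 by B^m, m the degree,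
  shows B | W_m, so B | A^m and B = 1.\<close>

lemma algebraic_int_quadratic_unit_trace:
  fixes x y :: real
  assumes "x * y = 1" "x + y \<in> \<rat>" "poly p x = 0" "poly p y = 0" "lead_coeff p = 1" "\<And>i. Polynomial.coeff p i \<in> \<int>"
  shows "x + y \<in> \<int>"
proof -
  obtain A B :: int where AB: "B > 0" "coprime A B" "x + y = of_int A / of_int B"
    using Rats_cases'[OF assms(2)] by metis
  define W where "W = (\<lambda>n. real_of_int B ^ n * (x ^ n + y ^ n))"
  have Wrec: "W (Suc (Suc n)) = of_int A * W (Suc n) - (of_int B)\<^sup>2 * W n" for n
  proof -
    have "W (Suc (Suc n)) = (of_int B * (x + y)) * W (Suc n) - (of_int B)\<^sup>2 * (x * y) * W n"
      unfolding W_def by (simp add: algebra_simps power2_eq_square)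
    then show ?thesis using AB assms(1) by simp
  qed
  \<comment> \<open>The congruence is stated only from index 1 on, because W_0 = 2.\<close>
  have W: "W n \<in> \<int> \<and> (\<exists>k. W (Suc n) = of_int (A ^ Suc n + B * k))" for n
  proof (induction n rule: induct_nat_012)
    case 0
    have "W (Suc 0) = of_int (A ^ Suc 0 + B * 0)" using AB by (simp add: W_def)
    then show ?case by (auto simp: W_def)
  next
    case 1
    have "W 0 = 2" "W (Suc 0) = of_int A" using AB by (simp_all add: W_def)
    then have "W (Suc (Suc 0)) = of_int (A ^ Suc (Suc 0) + B * (- 2 * B))"
      unfolding Wrec by (simp add: power2_eq_square)
    moreover have "W (Suc 0) \<in> \<int>" using \<open>W (Suc 0) = _\<close> by simp
    ultimately show ?case by blast
  next
    case (ge2 n)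
    then obtain k l where k: "W (Suc n) = of_int (A ^ Suc n + B * k)"
      and l: "W (Suc (Suc n)) = of_int (A ^ Suc (Suc n) + B * l)" by blast
    have "W (Suc (Suc (Suc n))) = of_int (A ^ Suc (Suc (Suc n)) + B * (A * l - B * (A ^ Suc n + B * k)))"
      unfolding Wrec[of "Suc n"] k l by (simp add: power2_eq_square algebra_simps)
    moreover have "W (Suc (Suc n)) \<in> \<int>" unfolding l by simp
    ultimately show ?case by blast
  qed
  define m where "m = degree p"
  have "m > 0" using assms by (intro Nat.gr0I) (auto simp: m_def elim!: degree_eq_zeroE)
  have "0 = of_int B ^ m * (poly p x + poly p y)" using assms by simp
  also have "\<dots> = (\<Sum>i\<le>m. Polynomial.coeff p i * (of_int B ^ (m - i) * W i))"
    unfolding poly_altdef m_def[symmetric] sum.distrib[symmetric] sum_distrib_left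
  proof (intro sum.cong refl)
    fix i assume "i \<in> {..m}"
    then have "of_int B ^ m = of_int B ^ (m - i) * (of_int B ^ i :: real)"
      by (simp flip: power_add)
    then show "of_int B ^ m * (Polynomial.coeff p i * x ^ i + Polynomial.coeff p i * y ^ i) = Polynomial.coeff p i * (of_int B ^ (m - i) * W i)"
      by (simp add: W_def algebra_simps)
  qed
  also have "{..m} = insert m {..<m}" by auto
  also have "(\<Sum>i\<in>insert m {..<m}. Polynomial.coeff p i * (of_int B ^ (m - i) * W i)) =
      W m + (\<Sum>i<m. Polynomial.coeff p i * (of_int B ^ (m - i) * W i))"
    using assms by (simp add: m_def)
  also have "(\<Sum>i<m. Polynomial.coeff p i * (of_int B ^ (m - i) * W i)) =
      of_int B * (\<Sum>i<m. Polynomial.coeff p i * (of_int B ^ (m - i - 1) * W i))"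
    unfolding sum_distrib_left
  proof (intro sum.cong refl)
    fix i assume "i \<in> {..<m}"
    then have "m - i = Suc (m - i - 1)" by auto
    then have "of_int B ^ (m - i) = of_int B * (of_int B ^ (m - i - 1) :: real)" by (metis power_Suc)
    then show "Polynomial.coeff p i * (of_int B ^ (m - i) * W i) = of_int B * (Polynomial.coeff p i * (of_int B ^ (m - i - 1) * W i))"
      by simp
  qed
  finally have eq: "W m = - of_int B * (\<Sum>i<m. Polynomial.coeff p i * (of_int B ^ (m - i - 1) * W i))" by simp
  have "(\<Sum>i<m. Polynomial.coeff p i * (of_int B ^ (m - i - 1) * W i)) \<in> \<int>"
    using assms W by (intro Ints_sum Ints_mult Ints_power) auto
  then obtain R where R: "(\<Sum>i<m. Polynomial.coeff p i * (of_int B ^ (m - i - 1) * W i)) = of_int R"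
    by (auto elim: Ints_cases)
  obtain k where "W m = of_int (A ^ m + B * k)"
    using W[of "m - 1"] \<open>m > 0\<close> by auto
  then have "real_of_int (A ^ m) = of_int (B * (- R - k))" using eq R by (simp add: algebra_simps)
  then have "A ^ m = B * (- R - k)" by (simp only: of_int_eq_iff)
  then have "B dvd A ^ m" by simp
  moreover have "coprime (A ^ m) B" using AB by simp
  ultimately have "is_unit B" by (metis coprime_common_divisor dvd_refl)
  then have "B = 1" using AB by simp
  then show ?thesis using AB by simp
qed

section \<open>Conjugation, embeddings and norm for Q(sqrt d)\<close>

context
  fixes d :: int
  assumes d: "d > 1" "squarefree d"
begin

lemma sqrt_squarefree_irrational: "sqrt (of_int d) \<notin> \<rat>"
proof
  assume "sqrt (of_int d) \<in> \<rat>"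
  moreover have "algebraic_int (sqrt (of_int d))" by (intro algebraic_int_sqrt int_imp_algebraic_int) simp
  ultimately have "sqrt (of_int d) \<in> \<int>" by (rule rational_algebraic_int_is_int[rotated])
  then obtain s where s: "sqrt (of_int d) = of_int s" by (auto elim: Ints_cases)
  then have "real_of_int d = (of_int s)\<^sup>2" using d by (metis less_imp_le of_int_0_le_iff real_sqrt_pow2 order_trans zero_le_one)
  then have "d = s\<^sup>2" by (metis of_int_eq_iff of_int_power)
  then have "is_unit s" using d squarefreeD[of d s] by simp
  then have "\<bar>s\<bar> = 1" by simp
  then have "s\<^sup>2 = 1" by (metis power2_abs power_one)
  then show False using d \<open>d = s\<^sup>2\<close> by simp
qed

lemma quadratic_field_repr_unique:
  assumes "of_rat a + of_rat b * sqrt (of_int d) = of_rat a' + of_rat b' * sqrt (of_int d)"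
  shows "a = a' \<and> b = b'"
proof -
  have eq: "of_rat (b - b') * sqrt (of_int d) = of_rat (a' - a)"
    using assms by (simp add: of_rat_diff algebra_simps)
  have "b = b'"
  proof (rule ccontr)
    assume "b \<noteq> b'"
    then have "sqrt (of_int d) = of_rat ((a' - a) / (b - b'))"
      using eq by (simp add: of_rat_divide of_rat_diff field_simps)
    then show False using sqrt_squarefree_irrational by (metis Rats_of_rat)
  qed
  then show ?thesis using eq by simp
qed

text \<open>The nontrivial automorphism of the field, which here is a bare set of reals. The
  description is determined on the field because the coordinates a, b are unique there.\<close>

definition conj_embedding :: "real \<Rightarrow> real" where
  "conj_embedding x = (THE y. \<exists>a b. x = of_rat a + of_rat b * sqrt (of_int d) \<and>
     y = of_rat a - of_rat b * sqrt (of_int d))"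

lemma conj_embedding_eq:
  "conj_embedding (of_rat a + of_rat b * sqrt (of_int d)) = of_rat a - of_rat b * sqrt (of_int d)"
  unfolding conj_embedding_def
  by (rule the_equality) (use quadratic_field_repr_unique in blast)+

lemma sqrt_mult_self: "sqrt (of_int d) * sqrt (of_int d) = of_int d"
  using d by simp

lemma quadratic_field_mult_repr:
  "(of_rat a + of_rat b * sqrt (of_int d)) * (of_rat a' + of_rat b' * sqrt (of_int d)) =
   of_rat (a * a' + b * b' * of_int d) + of_rat (a * b' + a' * b) * sqrt (of_int d)"
proof -
  have "(of_rat a + of_rat b * sqrt (of_int d)) * (of_rat a' + of_rat b' * sqrt (of_int d)) =
    of_rat a * of_rat a' + of_rat b * of_rat b' * (sqrt (of_int d) * sqrt (of_int d))
     + (of_rat a * of_rat b' + of_rat a' * of_rat b) * sqrt (of_int d)"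
    by (simp only: algebra_simps)
  then show ?thesis unfolding sqrt_mult_self by (simp add: of_rat_add of_rat_mult)
qed

lemma quadratic_field_add_repr:
  "(of_rat a + of_rat b * sqrt (of_int d)) + (of_rat a' + of_rat b' * sqrt (of_int d)) =
   of_rat (a + a') + of_rat (b + b') * sqrt (of_int d)"
  by (simp add: of_rat_add algebra_simps)

lemma quadratic_fieldE:
  assumes "x \<in> quadratic_field d"
  obtains a b where "x = of_rat a + of_rat b * sqrt (of_int d)"
  using assms by (auto simp: quadratic_field_def)

lemma quadratic_fieldI: "of_rat a + of_rat b * sqrt (of_int d) \<in> quadratic_field d"
  by (auto simp: quadratic_field_def)

lemma of_rat_in_quadratic_field: "of_rat a \<in> quadratic_field d"
  using quadratic_fieldI[of a 0] by simp

lemma quadratic_field_closed: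
  assumes "x \<in> quadratic_field d" "y \<in> quadratic_field d"
  shows "x + y \<in> quadratic_field d" "x * y \<in> quadratic_field d"
  using assms by (auto elim!: quadratic_fieldE simp only: quadratic_field_add_repr quadratic_field_mult_repr
      intro!: quadratic_fieldI)

lemma conj_embedding_of_rat [simp]: "conj_embedding (of_rat a) = of_rat a"
  using conj_embedding_eq[of a 0] by simp

lemma conj_embedding_hom:
  assumes "x \<in> quadratic_field d" "y \<in> quadratic_field d"
  shows "conj_embedding (x + y) = conj_embedding x + conj_embedding y"
    and "conj_embedding (x * y) = conj_embedding x * conj_embedding y"
proof -
  from assms obtain a b a' b' where *: "x = of_rat a + of_rat b * sqrt (of_int d)"
    "y = of_rat a' + of_rat b' * sqrt (of_int d)" by (metis quadratic_fieldE)
  show "conj_embedding (x + y) = conj_embedding x + conj_embedding y"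
    unfolding * quadratic_field_add_repr conj_embedding_eq by (simp add: of_rat_add algebra_simps)
  have "(of_rat a - of_rat b * sqrt (of_int d)) * (of_rat a' - of_rat b' * sqrt (of_int d)) =
    of_rat a * of_rat a' + of_rat b * of_rat b' * (sqrt (of_int d) * sqrt (of_int d))
     - (of_rat a * of_rat b' + of_rat a' * of_rat b) * sqrt (of_int d)"
    by (simp only: algebra_simps)
  then show "conj_embedding (x * y) = conj_embedding x * conj_embedding y"
    unfolding * quadratic_field_mult_repr conj_embedding_eq sqrt_mult_self
    by (simp add: of_rat_add of_rat_mult)
qed

lemma quadratic_field_power: "x \<in> quadratic_field d \<Longrightarrow> x ^ n \<in> quadratic_field d"
  using of_rat_in_quadratic_field[of 1] by (induction n) (auto intro: quadratic_field_closed)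

lemma conj_embedding_power:
  "x \<in> quadratic_field d \<Longrightarrow> conj_embedding (x ^ n) = conj_embedding x ^ n"
  using conj_embedding_of_rat[of 1]
  by (induction n) (auto simp: conj_embedding_hom quadratic_field_power)

lemma conj_embedding_minus_1:
  assumes "x \<in> quadratic_field d"
  shows "conj_embedding (x - 1) = conj_embedding x - 1" "x - 1 \<in> quadratic_field d"
  using conj_embedding_hom(1)[OF assms of_rat_in_quadratic_field[of "-1"]]
    quadratic_field_closed(1)[OF assms of_rat_in_quadratic_field[of "-1"]]
    conj_embedding_of_rat[of "-1"] by simp_all

text \<open>Serves to show that the conjugate of u is a root of the same monic integer polynomial as
  u.\<close>

lemma poly_conj_embedding:
  assumes "x \<in> quadratic_field d" "\<And>i. Polynomial.coeff p i \<in> \<int>"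
  shows "poly p x \<in> quadratic_field d \<and> conj_embedding (poly p x) = poly p (conj_embedding x)"
  using assms(2)
proof (induction p)
  case 0
  then show ?case using conj_embedding_of_rat[of 0] of_rat_in_quadratic_field[of 0] by simp
next
  case (pCons a p)
  have "Polynomial.coeff p i \<in> \<int>" for i using pCons.prems[of "Suc i"] by simp
  then have IH: "poly p x \<in> quadratic_field d" "conj_embedding (poly p x) = poly p (conj_embedding x)"
    using pCons.IH by auto
  obtain k where "a = of_int k" using pCons.prems[of 0] by (auto elim: Ints_cases)
  then have "a = of_rat (of_int k)" by simp
  then have a: "a \<in> quadratic_field d" "conj_embedding a = a"
    using of_rat_in_quadratic_field conj_embedding_of_rat by metis+
  show ?case using IH a assms(1) by (simp add: quadratic_field_closed conj_embedding_hom)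
qed

text \<open>Additivity and the value at 1 settle the naturals, additive inverses the integers, and
  multiplicativity the quotients.\<close>

lemma field_embedding_of_rat:
  assumes "\<sigma> \<in> field_embeddings (quadratic_field d)"
  shows "\<sigma> (of_rat q) = of_rat q"
proof -
  have hom: "\<sigma> 1 = 1" "\<And>x y. x \<in> quadratic_field d \<Longrightarrow> y \<in> quadratic_field d \<Longrightarrow> \<sigma> (x + y) = \<sigma> x + \<sigma> y"
     "\<And>x y. x \<in> quadratic_field d \<Longrightarrow> y \<in> quadratic_field d \<Longrightarrow> \<sigma> (x * y) = \<sigma> x * \<sigma> y"
    using assms by (auto simp: field_embeddings_def)
  have Q: "of_rat q \<in> quadratic_field d" for q by (rule of_rat_in_quadratic_field)
  have zero: "\<sigma> 0 = 0" using hom(2)[of 0 0] Q[of 0] by simp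
  have nat: "\<sigma> (of_nat n) = of_nat n" for n
  proof (induction n)
    case (Suc n)
    then show ?case using hom(1) hom(2)[of "of_nat n" 1] Q[of "of_nat n"] Q[of 1] by (simp add: add.commute)
  qed (simp add: zero)
  have int: "\<sigma> (of_int k) = of_int k" for k
  proof (cases k)
    case (neg n)
    have "\<sigma> (of_int k) + \<sigma> (of_nat (Suc n)) = \<sigma> (of_int k + of_nat (Suc n))"
      using hom(2)[of "of_int k" "of_nat (Suc n)"] Q[of "of_int k"] Q[of "of_nat (Suc n)"] by (simp add: of_rat_add)
    moreover have "real_of_int k + of_nat (Suc n) = 0" using neg by simp
    ultimately have "\<sigma> (of_int k) = - of_nat (Suc n)"
      using zero nat[of "Suc n"] by (simp only: eq_neg_iff_add_eq_0)
    then show ?thesis using neg by simp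
  qed (use nat in auto)
  obtain a b where ab: "q = of_int a / of_int b" "b \<noteq> 0"
    by (metis Fract_of_int_quotient Rat_cases less_irrefl)
  have "\<sigma> (of_rat q) * \<sigma> (of_int b) = \<sigma> (of_int a)"
    using hom(3)[of "of_rat q" "of_int b"] Q[of q] Q[of "of_int b"] ab by (simp add: of_rat_divide)
  then have "\<sigma> (of_rat q) = of_int a / of_int b" using ab(2) by (simp add: int field_simps)
  then show ?thesis using ab by (simp add: of_rat_divide)
qed

text \<open>The image of sqrt d squares to d, so it is one of two values, and it determines the
  embedding since rationals are fixed. Restriction makes both maps extensional.\<close>

lemma field_embeddings_quadratic:
  "field_embeddings (quadratic_field d) =
    {restrict complex_of_real (quadratic_field d),
     restrict (\<lambda>x. complex_of_real (conj_embedding x)) (quadratic_field d)}" (is "?L = {?e1, ?e2}")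
proof (intro equalityI subsetI)
  fix \<sigma> assume s: "\<sigma> \<in> ?L"
  define K where "K = quadratic_field d"
  define r where "r = sqrt (of_int d)"
  have hom: "\<And>x y. x \<in> K \<Longrightarrow> y \<in> K \<Longrightarrow> \<sigma> (x + y) = \<sigma> x + \<sigma> y"
     "\<And>x y. x \<in> K \<Longrightarrow> y \<in> K \<Longrightarrow> \<sigma> (x * y) = \<sigma> x * \<sigma> y"
    and ext: "\<sigma> \<in> extensional K"
    using s by (auto simp: field_embeddings_def K_def)
  have rat: "\<sigma> (of_rat q) = of_rat q" for q using s by (rule field_embedding_of_rat)
  have Q: "of_rat q \<in> K" for q unfolding K_def by (rule of_rat_in_quadratic_field)
  have rK: "r \<in> K" using quadratic_fieldI[of 0 1] by (simp add: K_def r_def)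
  have "\<sigma> r * \<sigma> r = \<sigma> (of_rat (of_int d))"
    using hom(2)[OF rK rK] unfolding r_def sqrt_mult_self by simp
  also have "\<dots> = of_rat (of_int d)" by (rule rat)
  also have "\<dots> = complex_of_real r * complex_of_real r"
    unfolding of_real_mult[symmetric] r_def sqrt_mult_self by simp
  finally have r: "\<sigma> r = of_real r \<or> \<sigma> r = - of_real r" by (simp add: square_eq_iff)
  have val: "\<sigma> (of_rat a + of_rat b * r) = of_rat a + of_rat b * \<sigma> r" for a b
    using hom Q rK rat by (metis K_def quadratic_field_closed(2))
  have of_real_rat: "complex_of_real (of_rat q) = of_rat q" for q
    by (cases q) (simp add: of_rat_rat)
  from r show "\<sigma> \<in> {?e1, ?e2}"
  proof
    assume r: "\<sigma> r = of_real r"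
    have "\<sigma> = ?e1"
    proof (rule extensionalityI)
      fix x assume "x \<in> K"
      then obtain a b where "x = of_rat a + of_rat b * r" unfolding K_def r_def by (rule quadratic_fieldE)
      then show "\<sigma> x = ?e1 x" using \<open>x \<in> K\<close> val[of a b] by (simp add: r K_def of_real_rat)
    qed (use ext in \<open>auto simp: K_def\<close>)
    then show ?thesis by simp
  next
    assume r: "\<sigma> r = - of_real r"
    have "\<sigma> = ?e2"
    proof (rule extensionalityI)
      fix x assume "x \<in> K"
      then obtain a b where "x = of_rat a + of_rat b * r" unfolding K_def r_def by (rule quadratic_fieldE)
      then show "\<sigma> x = ?e2 x" using \<open>x \<in> K\<close> val[of a b] conj_embedding_eq[of a b]
        by (simp add: r K_def of_real_rat flip: r_def)
    qed (use ext in \<open>auto simp: K_def\<close>)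
    then show ?thesis by simp
  qed
next
  fix \<sigma> assume "\<sigma> \<in> {?e1, ?e2}"
  then show "\<sigma> \<in> ?L"
    using of_rat_in_quadratic_field[of 1] conj_embedding_of_rat[of 1]
    by (auto simp: field_embeddings_def quadratic_field_closed conj_embedding_hom)
qed

lemma field_norm_quadratic:
  assumes "x \<in> quadratic_field d"
  shows "field_norm (quadratic_field d) x = of_real (x * conj_embedding x)"
proof -
  let ?e1 = "restrict complex_of_real (quadratic_field d)"
  let ?e2 = "restrict (\<lambda>x. complex_of_real (conj_embedding x)) (quadratic_field d)"
  have r: "sqrt (of_int d) \<in> quadratic_field d" using quadratic_fieldI[of 0 1] by simp
  \<comment> \<open>The two embeddings differ at sqrt d, so the product over the set of embeddings
    really has two factors.\<close>
  have "?e1 (sqrt (of_int d)) \<noteq> ?e2 (sqrt (of_int d))"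
    using r conj_embedding_eq[of 0 1] d by (simp flip: of_real_minus)
  then have "?e1 \<noteq> ?e2" by metis
  then show ?thesis using assms unfolding field_norm_def field_embeddings_quadratic by simp
qed

text \<open>Norm 1 makes the conjugate v equal to 1/u, so (u^n - 1) (v^n - 1) = 2 - V_n. The trace t
  is an integer, and t - 2 = (u - 1)^2 / u > 0 gives t >= 3.\<close>

lemma lehmer_pierce_eq_lp_seq:
  assumes u: "ring_unit (ring_of_integers (quadratic_field d)) u"
    and norm: "field_norm (quadratic_field d) u = 1" and pos: "u > 0" "u \<noteq> 1"
  obtains t where "t \<ge> 3" "u + 1 / u = of_int t" "lehmer_pierce d u = (\<lambda>n. - lp_seq t n)"
proof -
  have uK: "u \<in> quadratic_field d" and "algebraic_int u"
    using u by (auto simp: ring_unit_def ring_of_integers_def)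
  then obtain p where p: "lead_coeff p = 1" "\<And>i. Polynomial.coeff p i \<in> \<int>" "poly p u = 0"
    by (auto simp: algebraic_int.simps)
  define v where "v = conj_embedding u"
  have "of_real (u * v) = (1::complex)" using norm field_norm_quadratic[OF uK] by (simp add: v_def)
  then have uv: "u * v = 1" by (metis of_real_eq_1_iff)
  obtain a b where ab: "u = of_rat a + of_rat b * sqrt (of_int d)" using uK by (rule quadratic_fieldE)
  then have "v = of_rat a - of_rat b * sqrt (of_int d)" by (simp add: v_def conj_embedding_eq)
  with ab have "u + v = of_rat (2 * a)" by (simp add: of_rat_mult)
  then have "u + v \<in> \<rat>" by simp
  moreover have "poly p v = 0"
    using poly_conj_embedding[OF uK p(2)] p(3) conj_embedding_of_rat[of 0] by (simp add: v_def)
  ultimately have "u + v \<in> \<int>" using algebraic_int_quadratic_unit_trace uv p by blast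
  then obtain t where t: "u + v = of_int t" by (auto elim: Ints_cases)
  have v: "v = 1 / u" using uv pos by (simp add: field_simps)
  have "u + 1 / u - 2 = (u - 1)\<^sup>2 / u" using pos by (simp add: field_simps power2_eq_square)
  moreover have "(u - 1)\<^sup>2 / u > 0" using pos by simp
  ultimately have "real_of_int t > 2" using t v by simp
  then have "t \<ge> 3" by simp
  moreover have "u + 1 / u = of_int t" using t v by simp
  moreover have "lehmer_pierce d u n = - lp_seq t n" for n
  proof -
    have K: "u ^ n \<in> quadratic_field d" using uK by (rule quadratic_field_power)
    have "field_norm (quadratic_field d) (u ^ n - 1) = of_real ((u ^ n - 1) * (v ^ n - 1))"
      using field_norm_quadratic[OF conj_embedding_minus_1(2)[OF K]] conj_embedding_minus_1(1)[OF K]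
        conj_embedding_power[OF uK, of n] by (simp add: v_def)
    also have "(u ^ n - 1) * (v ^ n - 1) = (u * v) ^ n - (u ^ n + v ^ n) + 1"
      by (simp add: algebra_simps power_mult_distrib)
    also have "\<dots> = of_int (- lp_seq t n)"
      using trace_seq_closed_form[OF uv t, of n] uv by (simp add: lp_seq_def)
    finally have "field_norm (quadratic_field d) (u ^ n - 1) = of_int (- lp_seq t n)" by simp
    then show ?thesis unfolding lehmer_pierce_def by (simp only: of_int_eq_iff the_eq_trivial the_sym_eq_trivial)
  qed
  ultimately show ?thesis using that by blast
qed

end

section \<open>Small traces and the main theorem\<close>

lemma no_primitive_indices_uminus: "no_primitive_indices (\<lambda>n. - a n) = no_primitive_indices a"
  by (simp add: no_primitive_indices_def primitive_prime_divisor_def)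

lemma not_in_no_primitive_indicesI:
  assumes "prime p" "p dvd a n" "\<forall>m\<in>{1..<n}. \<not> p dvd a m"
  shows "n \<notin> no_primitive_indices a"
  using assms by (auto simp: no_primitive_indices_def primitive_prime_divisor_def)

text \<open>A term dividing a power of a product of earlier nonzero terms has no new prime; the
  exponent \<open>k\<close> only absorbs multiplicities, and i = j is allowed.\<close>

lemma in_no_primitive_indicesI:
  assumes "i \<in> {1..<n}" "j \<in> {1..<n}" "a i \<noteq> 0" "a j \<noteq> 0" "a n dvd (a i * a j) ^ k"
  shows "n \<in> no_primitive_indices a"
proof -
  have "\<not> primitive_prime_divisor a n p" for p
  proof
    assume p: "primitive_prime_divisor a n p"
    then have "prime p" "p dvd (a i * a j) ^ k"
      using assms(5) dvd_trans by (auto simp: primitive_prime_divisor_def)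
    then have "p dvd a i \<or> p dvd a j" by (metis prime_dvd_mult_iff prime_dvd_power)
    then show False using p assms(1-4) by (auto simp: primitive_prime_divisor_def)
  qed
  then show ?thesis using assms(1) by (auto simp: no_primitive_indices_def)
qed

lemma no_primitive_indices_lp_seq_le:
  assumes "t \<ge> 3"
  shows "no_primitive_indices (lp_seq t) \<subseteq> {1..6} \<union> (if t = 3 then {10, 12} else {})"
proof
  fix n assume n: "n \<in> no_primitive_indices (lp_seq t)"
  show "n \<in> {1..6} \<union> (if t = 3 then {10, 12} else {})"
  proof (cases "n > 6")
    case True
    then show ?thesis using lp_seq_primitive_prime_divisor[OF assms True] n
      by (auto simp: no_primitive_indices_def)
  next
    case False
    then show ?thesis using n by (auto simp: no_primitive_indices_def)
  qed
qed

section \<open>Exceptional indices for the traces 3, 4, 5 and 6\<close>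

lemma atLeastAtMost_1_6: "{1..6} = {1, 2, 3, 4, 5, 6 :: nat}"
  by auto

lemma atLeastLessThan_Suc_0_numeral:
  "{Suc 0..<2} = {1}" "{Suc 0..<3} = {1, 2}" "{Suc 0..<4} = {1, 2, 3}"
  "{Suc 0..<5} = {1, 2, 3, 4}" "{Suc 0..<6} = {1, 2, 3, 4, 5}"
  by auto

lemma no_primitive_indices_lp_seq_3: "no_primitive_indices (lp_seq 3) = {1, 6, 10, 12}"
proof -
  have v: "lp_seq 3 2 = 5" "lp_seq 3 3 = 16" "lp_seq 3 4 = 45" "lp_seq 3 5 = 121"
    "lp_seq 3 6 = 320" "lp_seq 3 10 = 15125" "lp_seq 3 12 = 103680"
    by (simp_all add: lp_seq_def eval_nat_numeral)
  have "2 \<notin> no_primitive_indices (lp_seq 3)"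
    by (rule not_in_no_primitive_indicesI[of 5]) (simp_all add: v atLeastLessThan_Suc_0_numeral)
  moreover have "3 \<notin> no_primitive_indices (lp_seq 3)"
    by (rule not_in_no_primitive_indicesI[of 2]) (simp_all add: v atLeastLessThan_Suc_0_numeral)
  moreover have "4 \<notin> no_primitive_indices (lp_seq 3)"
    by (rule not_in_no_primitive_indicesI[of 3]) (simp_all add: v atLeastLessThan_Suc_0_numeral)
  moreover have "5 \<notin> no_primitive_indices (lp_seq 3)"
    by (rule not_in_no_primitive_indicesI[of 11]) (simp_all add: v atLeastLessThan_Suc_0_numeral)
  \<comment> \<open>Here D_1 = 1 has no prime divisor at all, so 1 joins the indices 6, 10 and
    12.\<close>
  moreover have "1 \<in> no_primitive_indices (lp_seq 3)"
    by (auto simp: no_primitive_indices_def primitive_prime_divisor_def)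
  moreover have "6 \<in> no_primitive_indices (lp_seq 3)"
    by (rule in_no_primitive_indicesI[of 2 _ 3 _ 2]) (auto simp: v)
  moreover have "10 \<in> no_primitive_indices (lp_seq 3)"
    by (rule in_no_primitive_indicesI[of 2 _ 5 _ 3]) (auto simp: v)
  moreover have "12 \<in> no_primitive_indices (lp_seq 3)"
    by (rule in_no_primitive_indicesI[of 3 _ 4 _ 2]) (auto simp: v)
  moreover have "no_primitive_indices (lp_seq 3) \<subseteq> {1, 2, 3, 4, 5, 6, 10, 12}"
    using no_primitive_indices_lp_seq_le[of 3] unfolding atLeastAtMost_1_6 by auto
  ultimately show ?thesis by blast
qed

lemma no_primitive_indices_lp_seq_4: "no_primitive_indices (lp_seq 4) = {4, 6}"
proof -
  have v: "lp_seq 4 2 = 12" "lp_seq 4 3 = 50" "lp_seq 4 4 = 192" "lp_seq 4 5 = 722"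
    "lp_seq 4 6 = 2700"
    by (simp_all add: lp_seq_def eval_nat_numeral)
  have "1 \<notin> no_primitive_indices (lp_seq 4)"
    by (rule not_in_no_primitive_indicesI[of 2]) auto
  moreover have "2 \<notin> no_primitive_indices (lp_seq 4)"
    by (rule not_in_no_primitive_indicesI[of 3]) (simp_all add: v atLeastLessThan_Suc_0_numeral)
  moreover have "3 \<notin> no_primitive_indices (lp_seq 4)"
    by (rule not_in_no_primitive_indicesI[of 5]) (simp_all add: v atLeastLessThan_Suc_0_numeral)
  moreover have "5 \<notin> no_primitive_indices (lp_seq 4)"
    by (rule not_in_no_primitive_indicesI[of 19]) (simp_all add: v atLeastLessThan_Suc_0_numeral)
  moreover have "4 \<in> no_primitive_indices (lp_seq 4)"
    by (rule in_no_primitive_indicesI[of 2 _ 2 _ 3]) (auto simp: v)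
  moreover have "6 \<in> no_primitive_indices (lp_seq 4)"
    by (rule in_no_primitive_indicesI[of 2 _ 3 _ 3]) (auto simp: v)
  moreover have "no_primitive_indices (lp_seq 4) \<subseteq> {1, 2, 3, 4, 5, 6}"
    using no_primitive_indices_lp_seq_le[of 4] unfolding atLeastAtMost_1_6 by auto
  ultimately show ?thesis by blast
qed

lemma no_primitive_indices_lp_seq_5: "no_primitive_indices (lp_seq 5) = {6}"
proof -
  have v: "lp_seq 5 2 = 21" "lp_seq 5 3 = 108" "lp_seq 5 4 = 525" "lp_seq 5 5 = 2523"
    "lp_seq 5 6 = 12096"
    by (simp_all add: lp_seq_def eval_nat_numeral)
  have "1 \<notin> no_primitive_indices (lp_seq 5)"
    by (rule not_in_no_primitive_indicesI[of 3]) auto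
  moreover have "2 \<notin> no_primitive_indices (lp_seq 5)"
    by (rule not_in_no_primitive_indicesI[of 7]) (simp_all add: v atLeastLessThan_Suc_0_numeral)
  moreover have "3 \<notin> no_primitive_indices (lp_seq 5)"
    by (rule not_in_no_primitive_indicesI[of 2]) (simp_all add: v atLeastLessThan_Suc_0_numeral)
  moreover have "4 \<notin> no_primitive_indices (lp_seq 5)"
    by (rule not_in_no_primitive_indicesI[of 5]) (simp_all add: v atLeastLessThan_Suc_0_numeral)
  moreover have "5 \<notin> no_primitive_indices (lp_seq 5)"
    by (rule not_in_no_primitive_indicesI[of 29]) (simp_all add: v atLeastLessThan_Suc_0_numeral)
  moreover have "6 \<in> no_primitive_indices (lp_seq 5)"
    by (rule in_no_primitive_indicesI[of 2 _ 3 _ 3]) (auto simp: v)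
  moreover have "no_primitive_indices (lp_seq 5) \<subseteq> {1, 2, 3, 4, 5, 6}"
    using no_primitive_indices_lp_seq_le[of 5] unfolding atLeastAtMost_1_6 by auto
  ultimately show ?thesis by blast
qed

lemma no_primitive_indices_lp_seq_6: "no_primitive_indices (lp_seq 6) = {2}"
proof -
  have v: "lp_seq 6 2 = 32" "lp_seq 6 3 = 196" "lp_seq 6 4 = 1152" "lp_seq 6 5 = 6724"
    "lp_seq 6 6 = 39200"
    by (simp_all add: lp_seq_def eval_nat_numeral)
  have "1 \<notin> no_primitive_indices (lp_seq 6)"
    by (rule not_in_no_primitive_indicesI[of 2]) auto
  moreover have "3 \<notin> no_primitive_indices (lp_seq 6)"
    by (rule not_in_no_primitive_indicesI[of 7]) (simp_all add: v atLeastLessThan_Suc_0_numeral)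
  moreover have "4 \<notin> no_primitive_indices (lp_seq 6)"
    by (rule not_in_no_primitive_indicesI[of 3]) (simp_all add: v atLeastLessThan_Suc_0_numeral)
  moreover have "5 \<notin> no_primitive_indices (lp_seq 6)"
    by (rule not_in_no_primitive_indicesI[of 41]) (simp_all add: v atLeastLessThan_Suc_0_numeral)
  moreover have "6 \<notin> no_primitive_indices (lp_seq 6)"
    by (rule not_in_no_primitive_indicesI[of 5]) (simp_all add: v atLeastLessThan_Suc_0_numeral)
  moreover have "2 \<in> no_primitive_indices (lp_seq 6)"
    by (rule in_no_primitive_indicesI[of 1 _ 1 _ 3]) (auto simp: v)
  moreover have "no_primitive_indices (lp_seq 6) \<subseteq> {1, 2, 3, 4, 5, 6}"
    using no_primitive_indices_lp_seq_le[of 6] unfolding atLeastAtMost_1_6 by auto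
  ultimately show ?thesis by blast
qed

text \<open>The quadratic formula with an arbitrary root r of the discriminant, so that simplified
  surds such as 4 sqrt 2 can be supplied.\<close>

lemma unit_from_trace:
  fixes u t r :: real
  assumes "u \<noteq> 0" "u + 1 / u = t" "r\<^sup>2 = t\<^sup>2 - 4"
  shows "u = (t + r) / 2 \<or> u = (t - r) / 2"
proof -
  have "u\<^sup>2 + 1 = t * u" using assms(1,2) by (simp add: field_simps power2_eq_square)
  then have "(2 * u - t)\<^sup>2 = r\<^sup>2" using assms(3) by (simp add: power2_eq_square algebra_simps)
  then have "2 * u - t = r \<or> 2 * u - t = - r" by (simp add: power2_eq_iff)
  then show ?thesis by (auto simp: field_simps)
qed

theorem theorem3p1:
  fixes d :: int and u :: real
  assumes "d > 1" and "squarefree d"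
    and "ring_unit (ring_of_integers (quadratic_field d)) u"
    and "field_norm (quadratic_field d) u = 1"
    and "u > 0" and "u \<noteq> 1"
  shows "(u < 1/6 \<or> u > 6 \<longrightarrow> zsigmondy_bound (lehmer_pierce d u) \<le> 6) \<and>
    (\<not> (u < 1/6 \<or> u > 6) \<longrightarrow>
      (u \<in> {3 + 2 * sqrt 2, 3 - 2 * sqrt 2} \<and>
        zsigmondy_bound (lehmer_pierce d u) = 2) \<or>
      (u \<in> {2 + sqrt 3, 2 - sqrt 3} \<and>
        zsigmondy_bound (lehmer_pierce d u) = 6 \<and>
        no_primitive_indices (lehmer_pierce d u) = {4, 6}) \<or>
      (u \<in> {(3 + sqrt 5) / 2, (3 - sqrt 5) / 2} \<and>
        zsigmondy_bound (lehmer_pierce d u) = 12 \<and>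
        no_primitive_indices (lehmer_pierce d u) = {1, 6, 10, 12}) \<or>
      (u \<in> {(5 + sqrt 21) / 2, (5 - sqrt 21) / 2} \<and>
        zsigmondy_bound (lehmer_pierce d u) = 6 \<and>
        no_primitive_indices (lehmer_pierce d u) = {6}))"
proof -
  obtain t where t: "t \<ge> 3" "u + 1 / u = of_int t" "lehmer_pierce d u = (\<lambda>n. - lp_seq t n)"
    using lehmer_pierce_eq_lp_seq[OF assms] by blast
  have S: "no_primitive_indices (lehmer_pierce d u) = no_primitive_indices (lp_seq t)"
    unfolding t(3) by (rule no_primitive_indices_uminus)
  note z = zsigmondy_bound_def[of "lehmer_pierce d u", unfolded S Let_def]
  have u: "u\<^sup>2 + 1 = of_int t * u" using t(2) assms(5) by (simp add: field_simps power2_eq_square)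
  \<comment> \<open>Since 6 + 1/6 = 37/6, the sign of this product turns the condition on u into one
    on t: u lies outside [1/6, 6] exactly when t > 37/6.\<close>
  have prod: "(u - 6) * (u - 1 / 6) = (of_int t - 37 / 6) * u"
  proof -
    have "(u - 6) * (u - 1 / 6) = u\<^sup>2 + 1 - 37 / 6 * u"
      by (simp add: power2_eq_square field_simps)
    then show ?thesis unfolding u by (simp add: algebra_simps)
  qed
  show ?thesis
  proof (intro conjI impI)
    assume large: "u < 1 / 6 \<or> u > 6"
    then have "(u - 6) * (u - 1 / 6) > 0"
      by (auto intro: mult_pos_pos mult_neg_neg)
    then have "real_of_int t > 37 / 6" using assms(5) by (simp add: prod zero_less_mult_iff)
    then have "t > 3" by linarith
    then have sub: "no_primitive_indices (lp_seq t) \<subseteq> {1..6}"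
      using no_primitive_indices_lp_seq_le[of t] by simp
    then have fin: "finite (no_primitive_indices (lp_seq t))" by (rule finite_subset) simp
    show "zsigmondy_bound (lehmer_pierce d u) \<le> 6"
    proof (cases "no_primitive_indices (lp_seq t) = {}")
      case False
      then have "Max (no_primitive_indices (lp_seq t)) \<le> 6" using sub fin by auto
      then show ?thesis using fin False by (simp add: z numeral_eq_enat)
    qed (simp add: z)
  next
    assume "\<not> (u < 1 / 6 \<or> u > 6)"
    then have "(u - 6) * (u - 1 / 6) \<le> 0" by (intro mult_nonpos_nonneg) auto
    then have "real_of_int t \<le> 37 / 6" using assms(5) by (simp add: prod mult_le_0_iff)
    then have "t < 7" by linarith
    \<comment> \<open>Four traces remain, one for each pair u, 1/u in the statement.\<close>
    with t(1) consider "t = 6" | "t = 4" | "t = 3" | "t = 5" by linarith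
    then show "(u \<in> {3 + 2 * sqrt 2, 3 - 2 * sqrt 2} \<and>
        zsigmondy_bound (lehmer_pierce d u) = 2) \<or>
      (u \<in> {2 + sqrt 3, 2 - sqrt 3} \<and>
        zsigmondy_bound (lehmer_pierce d u) = 6 \<and>
        no_primitive_indices (lehmer_pierce d u) = {4, 6}) \<or>
      (u \<in> {(3 + sqrt 5) / 2, (3 - sqrt 5) / 2} \<and>
        zsigmondy_bound (lehmer_pierce d u) = 12 \<and>
        no_primitive_indices (lehmer_pierce d u) = {1, 6, 10, 12}) \<or>
      (u \<in> {(5 + sqrt 21) / 2, (5 - sqrt 21) / 2} \<and>
        zsigmondy_bound (lehmer_pierce d u) = 6 \<and>
        no_primitive_indices (lehmer_pierce d u) = {6})"
    proof cases
      case 1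
      have "u = (6 + 4 * sqrt 2) / 2 \<or> u = (6 - 4 * sqrt 2) / 2"
        using t(2) 1 assms(5) by (intro unit_from_trace) (auto simp: power_mult_distrib)
      then have "u \<in> {3 + 2 * sqrt 2, 3 - 2 * sqrt 2}" by auto
      moreover have "zsigmondy_bound (lehmer_pierce d u) = 2"
        unfolding z 1 no_primitive_indices_lp_seq_6 by (simp add: numeral_eq_enat)
      ultimately show ?thesis by blast
    next
      case 2
      have "u = (4 + 2 * sqrt 3) / 2 \<or> u = (4 - 2 * sqrt 3) / 2"
        using t(2) 2 assms(5) by (intro unit_from_trace) (auto simp: power_mult_distrib)
      then have "u \<in> {2 + sqrt 3, 2 - sqrt 3}" by auto
      moreover have "zsigmondy_bound (lehmer_pierce d u) = 6"
        unfolding z 2 no_primitive_indices_lp_seq_4 by (simp add: numeral_eq_enat)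
      ultimately show ?thesis unfolding S 2 no_primitive_indices_lp_seq_4 by blast
    next
      case 3
      have "u = (3 + sqrt 5) / 2 \<or> u = (3 - sqrt 5) / 2"
        using t(2) 3 assms(5) by (intro unit_from_trace) auto
      moreover have "zsigmondy_bound (lehmer_pierce d u) = 12"
        unfolding z 3 no_primitive_indices_lp_seq_3 by (simp add: numeral_eq_enat)
      ultimately show ?thesis unfolding S 3 no_primitive_indices_lp_seq_3 by blast
    next
      case 4
      have "u = (5 + sqrt 21) / 2 \<or> u = (5 - sqrt 21) / 2"
        using t(2) 4 assms(5) by (intro unit_from_trace) auto
      moreover have "zsigmondy_bound (lehmer_pierce d u) = 6"
        unfolding z 4 no_primitive_indices_lp_seq_5 by (simp add: numeral_eq_enat)
      ultimately show ?thesis unfolding S 4 no_primitive_indices_lp_seq_5 by blast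
    qed
  qed
qed

end
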